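(* Let $A$ be an abelian variety of dimension $g$ over a field $k$, embedded in $\mathbb{P}^r$ (projectively normally) by a very ample symmetric line bundle. If $S$ is a complete set of addition laws on $A$ with respect to this embedding, then $|S|\ge g+1$.
   Context: Let $\iota:A\hookrightarrow\mathbb{P}^r$ be the embedding, $\mu:A\times A\to A$ the group law, and $I_1\subset k[X_0,\dots,X_r]$, $I_2\subset k[Y_0,\dots,Y_r]$ the homogeneous ideals of $\iota(A)$. A line bundle $\mathcal{L}$ is symmetric if $[-1]^*\mathcal{L}\cong\mathcal{L}$; the embedding is projectively normal if $\Gamma(\mathbb{P}^r,\mathcal{O}(n))\to\Gamma(A,\mathcal{L}^n)$ is surjective for all $n\ge1$. An addition law of bidegree $(m,n)$ is an $(r+1)$-tuple $(p_0,\dots,p_r)$ of elements of $k[X_0,\dots,X_r]/I_1\otimes k[Y_0,\dots,Y_r]/I_2$, bihomogeneous of degree $m$ in the $X_i$ and $n$ in the $Y_i$, for which there is a nonempty open $U\subset A\times A$ with $\iota(\mu(x,y))=(p_0(\iota(x),\iota(y)):\dots:p_r(\iota(x),\iota(y)))$ for all $(x,y)\in U(\bar k)$; the law is said to be defined on such $U$. A set $S$ of addition laws is complete if for every point $(x,y)\in(A\times A)(\bar k)$ some addition law in $S$ is defined on an open set containing $(x,y)$. *)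

theory Defs
  imports
    "HOL-Library.Poly_Mapping"
    "HOL-Library.Extended_Nat"
    "HOL-Algebra.Algebraic_Closure_Type"
    "HOL-Algebra.QuotRing"
begin

text \<open>
  Varieties over a field \<open>k\<close> are described by their points over the algebraic closure of \<open>k\<close>.
  The field \<open>k\<close> is the type \<open>'k\<close>, its algebraic closure is \<open>'k alg_closure\<close>, and the embedding of
  the former into the latter is \<^const>\<open>to_ac\<close>. A finite index type \<open>'i\<close> with \<open>r + 1\<close> elements
  indexes the homogeneous coordinates of \<open>r\<close>-dimensional projective space.
\<close>

section \<open>Polynomials in several variables\<close>

type_synonym ('v, 'a) mpol = "('v \<Rightarrow>\<^sub>0 nat) \<Rightarrow>\<^sub>0 'a"

text \<open>
  Evaluation after mapping the coefficients by \<open>h\<close>: below \<open>h\<close> is \<^const>\<open>to_ac\<close> for polynomials over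
  \<open>k\<close> and \<^const>\<open>id\<close> for polynomials over the algebraic closure.
\<close>

definition evalp :: "('a::zero \<Rightarrow> 'b::comm_ring_1) \<Rightarrow> ('v, 'a) mpol \<Rightarrow> ('v \<Rightarrow> 'b) \<Rightarrow> 'b" where
  "evalp h p x =
     (\<Sum>t\<in>Poly_Mapping.keys p. h (Poly_Mapping.lookup p t) *
        (\<Prod>v\<in>Poly_Mapping.keys t. x v ^ Poly_Mapping.lookup t v))"

definition is_form :: "nat \<Rightarrow> ('i::finite, 'a::zero) mpol \<Rightarrow> bool" where
  "is_form n p \<longleftrightarrow> (\<forall>t\<in>Poly_Mapping.keys p. (\<Sum>i\<in>UNIV. Poly_Mapping.lookup t i) = n)"

text \<open>The variables \<open>Inl i\<close> are the \<open>X\<^sub>i\<close>, the variables \<open>Inr i\<close> are the \<open>Y\<^sub>i\<close>.\<close>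

definition is_biform :: "nat \<Rightarrow> nat \<Rightarrow> ('i::finite + 'i, 'a::zero) mpol \<Rightarrow> bool" where
  "is_biform m n p \<longleftrightarrow>
     (\<forall>t\<in>Poly_Mapping.keys p. (\<Sum>i\<in>UNIV. Poly_Mapping.lookup t (Inl i)) = m \<and>
                              (\<Sum>i\<in>UNIV. Poly_Mapping.lookup t (Inr i)) = n)"

definition rename_vars :: "('v \<Rightarrow> 'w) \<Rightarrow> ('v, 'a::comm_ring_1) mpol \<Rightarrow> ('w, 'a) mpol" where
  "rename_vars f p =
     (\<Sum>t\<in>Poly_Mapping.keys p.
        Poly_Mapping.single
          (\<Sum>v\<in>Poly_Mapping.keys t. Poly_Mapping.single (f v) (Poly_Mapping.lookup t v))
          (Poly_Mapping.lookup p t))"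

abbreviation mpol_ring :: "('v, 'a::comm_ring_1) mpol ring" where
  "mpol_ring \<equiv> ring_of_type_algebra"


section \<open>Projective space and its Zariski topologies\<close>

definition proj_rel :: "('i \<Rightarrow> 'a::field) \<Rightarrow> ('i \<Rightarrow> 'a) \<Rightarrow> bool" where
  "proj_rel x y \<longleftrightarrow> x \<noteq> (\<lambda>_. 0) \<and> (\<exists>c. c \<noteq> 0 \<and> y = (\<lambda>i. c * x i))"

lemma part_equivp_proj_rel: "part_equivp (proj_rel :: ('i \<Rightarrow> 'a::field) \<Rightarrow> _)"
proof (rule part_equivpI)
  show "\<exists>x :: 'i \<Rightarrow> 'a. proj_rel x x"
    by (rule exI[of _ "\<lambda>_. 1"]) (auto simp: proj_rel_def fun_eq_iff intro: exI[of _ 1])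
  show "symp (proj_rel :: ('i \<Rightarrow> 'a) \<Rightarrow> _)"
  proof (rule sympI)
    fix x y :: "'i \<Rightarrow> 'a"
    assume "proj_rel x y"
    then obtain c where c: "c \<noteq> 0" "y = (\<lambda>i. c * x i)" and x: "x \<noteq> (\<lambda>_. 0)"
      by (auto simp: proj_rel_def)
    have "x = (\<lambda>i. inverse c * y i)" using c by (auto simp: fun_eq_iff)
    moreover have "y \<noteq> (\<lambda>_. 0)" using c x by (auto simp: fun_eq_iff)
    ultimately show "proj_rel y x"
      using c(1) unfolding proj_rel_def by (metis nonzero_imp_inverse_nonzero)
  qed
  show "transp (proj_rel :: ('i \<Rightarrow> 'a) \<Rightarrow> _)"
  proof (rule transpI)
    fix x y z :: "'i \<Rightarrow> 'a"
    assume "proj_rel x y" "proj_rel y z"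
    then obtain c d where "c \<noteq> 0" "d \<noteq> 0" "z = (\<lambda>i. d * (c * x i))" "x \<noteq> (\<lambda>_. 0)"
      by (auto simp: proj_rel_def)
    then show "proj_rel x z"
      by (auto simp: proj_rel_def intro!: exI[of _ "d * c"])
  qed
qed

quotient_type (overloaded) ('i, 'a) proj_space = "'i \<Rightarrow> 'a::field" / partial: proj_rel
  by (rule part_equivp_proj_rel)

text \<open>\<open>hcoords P\<close> is some choice of homogeneous coordinates of \<open>P\<close>.\<close>

abbreviation hcoords :: "('i, 'a::field) proj_space \<Rightarrow> 'i \<Rightarrow> 'a" where
  "hcoords \<equiv> rep_proj_space"

definition has_hcoords :: "('i, 'a::field) proj_space \<Rightarrow> ('i \<Rightarrow> 'a) \<Rightarrow> bool" where
  "has_hcoords P x \<longleftrightarrow> x \<noteq> (\<lambda>_. 0) \<and> abs_proj_space x = P"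

abbreviation hcoords2 ::
  "('i, 'a::field) proj_space \<times> ('i, 'a) proj_space \<Rightarrow> 'i + 'i \<Rightarrow> 'a" where
  "hcoords2 z \<equiv> case_sum (hcoords (fst z)) (hcoords (snd z))"

definition zariski_closed ::
  "('a::zero \<Rightarrow> 'b::field) \<Rightarrow> ('i::finite, 'b) proj_space set \<Rightarrow> bool" where
  "zariski_closed h Z \<longleftrightarrow>
     (\<exists>T. (\<forall>F\<in>T. \<exists>n. is_form n F) \<and> Z = {P. \<forall>F\<in>T. evalp h F (hcoords P) = 0})"

text \<open>Closed subsets of the product of two projective spaces.\<close>

definition zariski_closed2 ::
  "('a::zero \<Rightarrow> 'b::field) \<Rightarrow>
   (('i::finite, 'b) proj_space \<times> ('i, 'b) proj_space) set \<Rightarrow> bool" where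
  "zariski_closed2 h Z \<longleftrightarrow>
     (\<exists>T. (\<forall>F\<in>T. \<exists>m n. is_biform m n F) \<and> Z = {z. \<forall>F\<in>T. evalp h F (hcoords2 z) = 0})"

abbreviation k_open :: "('i::finite, 'k::field alg_closure) proj_space set \<Rightarrow> bool" where
  "k_open W \<equiv> zariski_closed to_ac (- W)"

abbreviation k_open2 ::
  "(('i::finite, 'k::field alg_closure) proj_space \<times> ('i, 'k alg_closure) proj_space) set \<Rightarrow> bool"
  where "k_open2 W \<equiv> zariski_closed2 to_ac (- W)"

definition irreducible_closed :: "('i::finite, 'a::field) proj_space set \<Rightarrow> bool" where
  "irreducible_closed Z \<longleftrightarrow> zariski_closed id Z \<and> Z \<noteq> {} \<and>
     (\<forall>Z1 Z2. zariski_closed id Z1 \<and> zariski_closed id Z2 \<and> Z \<subseteq> Z1 \<union> Z2 \<longrightarrow> Z \<subseteq> Z1 \<or> Z \<subseteq> Z2)"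

definition krull_dim :: "('i::finite, 'a::field) proj_space set \<Rightarrow> enat" where
  "krull_dim V = Sup {enat n | n. \<exists>Z :: nat \<Rightarrow> _.
     (\<forall>i\<le>n. irreducible_closed (Z i) \<and> Z i \<subseteq> V) \<and> (\<forall>i<n. Z i \<subset> Z (Suc i))}"


section \<open>Projective varieties over \<open>k\<close>, regular functions, morphisms\<close>

definition hom_ideal ::
  "('a::comm_ring_1 \<Rightarrow> 'b::field) \<Rightarrow> ('i::finite, 'b) proj_space set \<Rightarrow> ('i, 'a) mpol set" where
  "hom_ideal h V =
     Idl\<^bsub>mpol_ring\<^esub> {F. (\<exists>n. is_form n F) \<and> (\<forall>P\<in>V. evalp h F (hcoords P) = 0)}"

text \<open>
  Geometrically integral closed \<open>k\<close>-subschemes of projective space: the point set over the algebraic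
  closure is irreducible, and its ideal is generated by polynomials over \<open>k\<close>. For imperfect \<open>k\<close> the
  second condition is stronger than being closed in the \<open>k\<close>-topology; it says that the subscheme
  cut out by \<open>hom_ideal to_ac V\<close> is geometrically reduced.
\<close>

definition projective_variety :: "('i::finite, 'k::field alg_closure) proj_space set \<Rightarrow> bool" where
  "projective_variety V \<longleftrightarrow> irreducible_closed V \<and>
     hom_ideal id V = Idl\<^bsub>mpol_ring\<^esub> (Poly_Mapping.map to_ac ` hom_ideal to_ac V)"

text \<open>Functions regular over \<open>k\<close> on a locally closed set \<open>U\<close>.\<close>

definition regular_on ::
  "('i::finite, 'k::field alg_closure) proj_space set \<Rightarrow>
   (('i, 'k alg_closure) proj_space \<Rightarrow> 'k alg_closure) \<Rightarrow> bool" where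
  "regular_on U f \<longleftrightarrow>
     (\<forall>P\<in>U. \<exists>W n F G. k_open W \<and> P \<in> W \<and> is_form n F \<and> is_form n G \<and>
        (\<forall>Q\<in>U \<inter> W. evalp to_ac G (hcoords Q) \<noteq> 0 \<and>
                    f Q = evalp to_ac F (hcoords Q) / evalp to_ac G (hcoords Q)))"

text \<open>Morphisms over \<open>k\<close> from \<open>V\<close>, and from \<open>V \<times> V\<close>, to projective space.\<close>

definition k_morphism ::
  "('i::finite, 'k::field alg_closure) proj_space set \<Rightarrow>
   (('i, 'k alg_closure) proj_space \<Rightarrow> ('j, 'k alg_closure) proj_space) \<Rightarrow> bool" where
  "k_morphism V \<phi> \<longleftrightarrow>
     (\<forall>P\<in>V. \<exists>W n F. k_open W \<and> P \<in> W \<and> (\<forall>j. is_form n (F j)) \<and>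
        (\<forall>Q\<in>V \<inter> W. has_hcoords (\<phi> Q) (\<lambda>j. evalp to_ac (F j) (hcoords Q))))"

definition k_morphism2 ::
  "('i::finite, 'k::field alg_closure) proj_space set \<Rightarrow>
   (('i, 'k alg_closure) proj_space \<Rightarrow> ('i, 'k alg_closure) proj_space \<Rightarrow>
    ('j, 'k alg_closure) proj_space) \<Rightarrow> bool" where
  "k_morphism2 V \<phi> \<longleftrightarrow>
     (\<forall>z\<in>V \<times> V. \<exists>W m n F. k_open2 W \<and> z \<in> W \<and> (\<forall>j. is_biform m n (F j)) \<and>
        (\<forall>w\<in>(V \<times> V) \<inter> W.
           has_hcoords (\<phi> (fst w) (snd w)) (\<lambda>j. evalp to_ac (F j) (hcoords2 w))))"

definition k_rational :: "('i, 'k::field alg_closure) proj_space \<Rightarrow> bool" where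
  "k_rational P \<longleftrightarrow> (\<exists>c :: 'i \<Rightarrow> 'k. has_hcoords P (\<lambda>i. to_ac (c i)))"

text \<open>
  An abelian variety over \<open>k\<close>, identified with its image under the given closed embedding. The carrier
  is its set of points over the algebraic closure. Neither smoothness nor commutativity is required,
  both being consequences.
\<close>

definition abelian_variety :: "('i::finite, 'k::field alg_closure) proj_space monoid \<Rightarrow> bool" where
  "abelian_variety A \<longleftrightarrow> projective_variety (carrier A) \<and> group A \<and>
     k_rational \<one>\<^bsub>A\<^esub> \<and>
     k_morphism2 (carrier A) (\<lambda>P Q. P \<otimes>\<^bsub>A\<^esub> Q) \<and>
     k_morphism (carrier A) (\<lambda>P. inv\<^bsub>A\<^esub> P)"


section \<open>Line bundles\<close>

text \<open>
  Line bundles on \<open>V\<close> over \<open>k\<close> are given by trivialising open sets and cocycles: in a section, the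
  local functions \<open>s\<^sub>j\<close> satisfy \<open>s\<^sub>j = trans j l * s\<^sub>l\<close> where both are defined.
\<close>

record ('j, 'p, 'a) line_bundle =
  chart :: "'j \<Rightarrow> 'p set"
  trans :: "'j \<Rightarrow> 'j \<Rightarrow> 'p \<Rightarrow> 'a"

definition lb_sections ::
  "('i::finite, 'k::field alg_closure) proj_space set \<Rightarrow>
   ('j, ('i, 'k alg_closure) proj_space, 'k alg_closure) line_bundle \<Rightarrow>
   ('j \<Rightarrow> ('i, 'k alg_closure) proj_space \<Rightarrow> 'k alg_closure) set" where
  "lb_sections V L =
     {s. (\<forall>j. regular_on (V \<inter> chart L j) (s j)) \<and>
         (\<forall>j l. \<forall>P\<in>V \<inter> chart L j \<inter> chart L l. s j P = trans L j l P * s l P)}"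

text \<open>An isomorphism multiplies by a unit \<open>h j a\<close> from the trivialisation \<open>j\<close> of \<open>L\<close> to the
  trivialisation \<open>a\<close> of \<open>L'\<close>.\<close>

definition lb_iso ::
  "('i::finite, 'k::field alg_closure) proj_space set \<Rightarrow>
   ('j, ('i, 'k alg_closure) proj_space, 'k alg_closure) line_bundle \<Rightarrow>
   ('j', ('i, 'k alg_closure) proj_space, 'k alg_closure) line_bundle \<Rightarrow> bool" where
  "lb_iso V L L' \<longleftrightarrow> (\<exists>h.
     (\<forall>j a. regular_on (V \<inter> chart L j \<inter> chart L' a) (h j a) \<and>
            (\<forall>P\<in>V \<inter> chart L j \<inter> chart L' a. h j a P \<noteq> 0)) \<and>
     (\<forall>j l a b. \<forall>P\<in>V \<inter> chart L j \<inter> chart L l \<inter> chart L' a \<inter> chart L' b.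
        h j a P * trans L j l P = trans L' a b P * h l b P))"

definition lb_pullback :: "('p \<Rightarrow> 'q) \<Rightarrow> ('j, 'q, 'a) line_bundle \<Rightarrow> ('j, 'p, 'a) line_bundle" where
  "lb_pullback \<phi> L =
     \<lparr>chart = (\<lambda>j. \<phi> -` chart L j), trans = (\<lambda>j l P. trans L j l (\<phi> P))\<rparr>"

definition lb_power ::
  "('j, 'p, 'a::comm_ring_1) line_bundle \<Rightarrow> nat \<Rightarrow> ('j, 'p, 'a) line_bundle" where
  "lb_power L n = \<lparr>chart = chart L, trans = (\<lambda>j l P. trans L j l P ^ n)\<rparr>"

text \<open>The line bundle \<open>\<O>(1)\<close>, whose restriction to \<open>V\<close> is the very ample bundle of the embedding.\<close>

definition O1 :: "('i, ('i, 'a) proj_space, 'a::field) line_bundle" where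
  "O1 = \<lparr>chart = (\<lambda>i. {P. hcoords P i \<noteq> 0}), trans = (\<lambda>i j P. hcoords P j / hcoords P i)\<rparr>"

definition symmetric_embedding ::
  "('i::finite, 'k::field alg_closure) proj_space monoid \<Rightarrow> bool" where
  "symmetric_embedding A \<longleftrightarrow> lb_iso (carrier A) (lb_pullback (\<lambda>P. inv\<^bsub>A\<^esub> P) O1) O1"

text \<open>The form \<open>F\<close> of degree \<open>n\<close>, as a section of \<open>\<O>(n)\<close>, is \<open>F / X\<^sub>i\<^sup>n\<close> in the chart \<open>i\<close>.\<close>

definition projectively_normal ::
  "('i::finite, 'k::field alg_closure) proj_space set \<Rightarrow> bool" where
  "projectively_normal V \<longleftrightarrow>
     (\<forall>n\<ge>1. \<forall>s\<in>lb_sections V (lb_power O1 n). \<exists>F. is_form n F \<and>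
        (\<forall>i. \<forall>P\<in>V \<inter> chart O1 i. s i P = evalp to_ac F (hcoords P) / hcoords P i ^ n))"


section \<open>Addition laws\<close>

text \<open>
  With \<open>I\<^sub>1\<close> and \<open>I\<^sub>2\<close> the ideals of \<open>V\<close> in the variables \<open>X\<close> and \<open>Y\<close>, the tensor product of
  \<open>k[X] / I\<^sub>1\<close> and \<open>k[Y] / I\<^sub>2\<close> over \<open>k\<close> is the quotient of \<open>k[X, Y]\<close> by the ideal generated by
  \<open>I\<^sub>1\<close> and \<open>I\<^sub>2\<close>.
\<close>

definition product_ideal ::
  "('i::finite, 'k::field alg_closure) proj_space set \<Rightarrow> ('i + 'i, 'k) mpol set" where
  "product_ideal V =
     Idl\<^bsub>mpol_ring\<^esub> (rename_vars Inl ` hom_ideal to_ac V \<union> rename_vars Inr ` hom_ideal to_ac V)"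

abbreviation bicoord_ring ::
  "('i::finite, 'k::field alg_closure) proj_space set \<Rightarrow> ('i + 'i, 'k) mpol set ring" where
  "bicoord_ring V \<equiv> mpol_ring Quot product_ideal V"

definition bihomogeneous ::
  "('i::finite, 'k::field alg_closure) proj_space set \<Rightarrow> nat \<Rightarrow> nat \<Rightarrow>
   ('i + 'i, 'k) mpol set \<Rightarrow> bool" where
  "bihomogeneous V m n c \<longleftrightarrow> c \<in> carrier (bicoord_ring V) \<and> (\<exists>q\<in>c. is_biform m n q)"

text \<open>All representatives of an element of \<open>bicoord_ring V\<close> have the same value on \<open>V \<times> V\<close>.\<close>

definition coset_value ::
  "('i, 'k::field alg_closure) proj_space \<times> ('i, 'k alg_closure) proj_space \<Rightarrow>
   ('i + 'i, 'k) mpol set \<Rightarrow> 'k alg_closure" where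
  "coset_value z c = the_elem ((\<lambda>q. evalp to_ac q (hcoords2 z)) ` c)"

definition open_in_square ::
  "('i::finite, 'k::field alg_closure) proj_space set \<Rightarrow>
   (('i, 'k alg_closure) proj_space \<times> ('i, 'k alg_closure) proj_space) set \<Rightarrow> bool" where
  "open_in_square V U \<longleftrightarrow> (\<exists>W. k_open2 W \<and> U = (V \<times> V) \<inter> W)"

definition law_defined_on ::
  "('i::finite, 'k::field alg_closure) proj_space monoid \<Rightarrow> ('i \<Rightarrow> ('i + 'i, 'k) mpol set) \<Rightarrow>
   (('i, 'k alg_closure) proj_space \<times> ('i, 'k alg_closure) proj_space) set \<Rightarrow> bool" where
  "law_defined_on A p U \<longleftrightarrow> open_in_square (carrier A) U \<and>
     (\<forall>(P, Q)\<in>U. has_hcoords (P \<otimes>\<^bsub>A\<^esub> Q) (\<lambda>i. coset_value (P, Q) (p i)))"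

definition addition_law ::
  "('i::finite, 'k::field alg_closure) proj_space monoid \<Rightarrow> nat \<Rightarrow> nat \<Rightarrow>
   ('i \<Rightarrow> ('i + 'i, 'k) mpol set) \<Rightarrow> bool" where
  "addition_law A m n p \<longleftrightarrow>
     (\<forall>i. bihomogeneous (carrier A) m n (p i)) \<and> (\<exists>U. U \<noteq> {} \<and> law_defined_on A p U)"

definition complete_addition_laws ::
  "('i::finite, 'k::field alg_closure) proj_space monoid \<Rightarrow>
   ('i \<Rightarrow> ('i + 'i, 'k) mpol set) set \<Rightarrow> bool" where
  "complete_addition_laws A S \<longleftrightarrow>
     (\<forall>p\<in>S. \<exists>m n. addition_law A m n p) \<and>
     (\<forall>z\<in>carrier A \<times> carrier A. \<exists>p\<in>S. \<exists>U. z \<in> U \<and> law_defined_on A p U)"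

end

theory Submission
  imports Defs
begin

text \<open>
  Restrict the addition laws to the antidiagonal \<open>{(x, -x)}\<close>, on which the group law is constant. By
  symmetry and projective normality \<open>x \<mapsto> -x\<close> is given by linear forms \<open>L\<close>. If the \<open>i\<close>-th coordinate of
  the neutral element is nonzero, then for a law \<open>p\<close> of bidegree \<open>(m, n)\<close> the form \<open>p\<^sub>i(x, L(x))\<close> of degree
  \<open>m + n\<close> does not vanish at any \<open>x\<close> such that \<open>p\<close> is defined at \<open>(x, -x)\<close>. Hence for a complete set of
  laws these forms, of positive degree if \<open>g > 0\<close>, have no common zero on \<open>A\<close>; but \<open>g\<close> forms of positive
  degree have a common zero on a variety of dimension \<open>g\<close>.

  The last fact is proved by comparing Hilbert functions. A chain of irreducible closed sets of length
  \<open>g\<close> forces the Hilbert function of \<open>A\<close> to grow like a polynomial of degree \<open>g\<close>. If \<open>s\<close> forms of positive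
  degree have no common zero on \<open>A\<close>, then by the projective Nullstellensatz the Hilbert function
  vanishes eventually modulo these forms, so it is bounded by a polynomial of degree \<open>s - 1\<close>.
\<close>

section \<open>Forms as functions\<close>

text \<open>Gaussian elimination by induction on the equations \<open>B\<close>: one with a nonzero
  coefficient at \<open>a0\<close> eliminates that unknown. This stands in for dimension theory
  below, both for finding a binary form in an ideal and for comparing independent with spanning
  forms.\<close>

lemma underdetermined_system:
  fixes M :: "'u \<Rightarrow> 'v \<Rightarrow> 'a::field"
  assumes "finite B" "finite A" "card B < card A"
  shows "\<exists>c. (\<exists>a\<in>A. c a \<noteq> 0) \<and> (\<forall>b\<in>B. (\<Sum>a\<in>A. c a * M a b) = 0)"
  using assms
proof (induction B arbitrary: A M rule: finite_induct)
  case empty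
  then show ?case by (intro exI[of _ "\<lambda>_. 1"]) (auto simp: card_gt_0_iff)
next
  case (insert b B)
  show ?case
  proof (cases "\<forall>a\<in>A. M a b = 0")
    case True
    have "card B < card A" using insert by simp
    from insert.IH[OF insert.prems(1) this, of M] True show ?thesis by auto
  next
    case False
    then obtain a0 where a0: "a0 \<in> A" "M a0 b \<noteq> 0" by auto
    define M' where "M' = (\<lambda>a v. M a v - M a b / M a0 b * M a0 v)"
    have "card B < card (A - {a0})" using insert a0 by simp
    with insert.IH[of "A - {a0}" M'] insert.prems obtain c where
      c: "\<exists>a\<in>A - {a0}. c a \<noteq> 0" "\<And>v. v \<in> B \<Longrightarrow> (\<Sum>a\<in>A - {a0}. c a * M' a v) = 0"
      by auto
    \<comment> \<open>With value \<open>- k\<close> for the unknown \<open>a0\<close>, the equation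
      \<open>b\<close> holds.\<close>
    define k where "k = (\<Sum>a\<in>A - {a0}. c a * M a b) / M a0 b"
    define c' where "c' = c(a0 := - k)"
    have sum_c': "(\<Sum>a\<in>A. c' a * M a v) = (\<Sum>a\<in>A - {a0}. c a * M a v) - k * M a0 v" for v
    proof -
      have "(\<Sum>a\<in>A. c' a * M a v) = c' a0 * M a0 v + (\<Sum>a\<in>A - {a0}. c' a * M a v)"
        using a0 insert.prems by (simp add: sum.remove)
      also have "(\<Sum>a\<in>A - {a0}. c' a * M a v) = (\<Sum>a\<in>A - {a0}. c a * M a v)"
        by (intro sum.cong) (auto simp: c'_def)
      finally show ?thesis by (simp add: c'_def)
    qed
    have "(\<Sum>a\<in>A. c' a * M a v) = 0" if "v \<in> insert b B" for v
    proof (cases "v = b")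
      case True
      then show ?thesis using a0 by (simp add: sum_c' k_def)
    next
      case False
      then have "v \<in> B" using that by simp
      from c(2)[OF this] have "0 = (\<Sum>a\<in>A - {a0}. c a * M a v) - k * M a0 v"
        by (simp add: M'_def k_def right_diff_distrib sum_subtractf sum_distrib_right
            sum_divide_distrib mult.assoc)
      then show ?thesis by (simp add: sum_c')
    qed
    moreover have "\<exists>a\<in>A. c' a \<noteq> 0" using c(1) by (auto simp: c'_def)
    ultimately show ?thesis by blast
  qed
qed

text \<open>Forms are represented by the functions they define on affine space, and a graded ideal below by
  the set of pairs of a degree and a form of this degree in it.\<close>

inductive hform :: "nat \<Rightarrow> (('v \<Rightarrow> 'a::field) \<Rightarrow> 'a) \<Rightarrow> bool" where
  hform_const: "hform 0 (\<lambda>_. c)"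
| hform_zero: "hform n (\<lambda>_. 0)"
| hform_add: "hform n f \<Longrightarrow> hform n g \<Longrightarrow> hform n (\<lambda>x. f x + g x)"
| hform_times_var: "hform n f \<Longrightarrow> hform (Suc n) (\<lambda>x. x i * f x)"

lemma hform_var: "hform 1 (\<lambda>x. x i)"
  using hform_times_var[OF hform_const[of 1], of i] by simp

lemma hform_scale: "hform n f \<Longrightarrow> hform n (\<lambda>x. c * f x)"
proof (induction rule: hform.induct)
  case (hform_add n f g)
  then show ?case using hform.hform_add by (fastforce simp: distrib_left)
next
  case (hform_times_var n f i)
  then show ?case using hform.hform_times_var[of n "\<lambda>x. c * f x" i] by (simp add: mult.left_commute)
qed (auto intro: hform.intros)

lemma hform_diff: "hform n f \<Longrightarrow> hform n g \<Longrightarrow> hform n (\<lambda>x. f x - g x)"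
  using hform_add[of n f "\<lambda>x. -1 * g x"] hform_scale[of n g "-1"] by simp

lemma hform_mult: "hform m f \<Longrightarrow> hform n g \<Longrightarrow> hform (m + n) (\<lambda>x. f x * g x)"
proof (induction rule: hform.induct)
  case (hform_const c)
  then show ?case by (simp add: hform_scale)
next
  case (hform_add m f f')
  then show ?case using hform.hform_add[of "m + n" "\<lambda>x. f x * g x" "\<lambda>x. f' x * g x"]
    by (simp add: distrib_right)
next
  case (hform_times_var m f i)
  then show ?case using hform.hform_times_var[of "m + n" "\<lambda>x. f x * g x" i] by (simp add: mult.assoc)
qed (auto intro: hform.intros)

lemma hform_sum: "(\<And>a. a \<in> A \<Longrightarrow> hform n (f a)) \<Longrightarrow> hform n (\<lambda>x. \<Sum>a\<in>A. f a x)"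
  by (induction A rule: infinite_finite_induct) (auto intro: hform.intros)

lemma hform_prod:
  "(\<And>a. a \<in> A \<Longrightarrow> hform (d a) (f a)) \<Longrightarrow> hform (\<Sum>a\<in>A. d a) (\<lambda>x. \<Prod>a\<in>A. f a x)"
  by (induction A rule: infinite_finite_induct) (auto intro: hform_const hform_mult)

lemma hform_power: "hform n f \<Longrightarrow> hform (n * k) (\<lambda>x. f x ^ k)"
  by (induction k) (auto intro: hform_const hform_mult)

lemma hform_prod_list: "hform (length l) (\<lambda>x. prod_list (map x l))"
  by (induction l) (auto intro: hform_const hform_times_var)

lemma hform_homogeneous: "hform n f \<Longrightarrow> f (\<lambda>i. c * x i) = c ^ n * f x"
  by (induction rule: hform.induct) (auto simp: algebra_simps)

lemma hform_0_const:
  assumes "hform 0 f"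
  shows "f x = f y"
  \<comment> \<open>Homogeneity with \<open>c = 0\<close> and \<open>0 ^ 0 = 1\<close> equates every
    value of \<open>f\<close> with its value at the origin.\<close>
  using hform_homogeneous[OF assms, of 0 x] hform_homogeneous[OF assms, of 0 y] by simp

lemma finite_lists_length: "finite {l :: 'i::finite list. length l = m}"
  using finite_lists_length_eq[of "UNIV :: 'i set" m] by simp

text \<open>Monomials are indexed by words in the variables, so one monomial occurs under several
  words and \<open>c\<close> is not unique. Only the existence of a finite spanning set is
  used.\<close>

lemma hform_monomials:
  fixes f :: "('i::finite \<Rightarrow> 'a::field) \<Rightarrow> 'a"
  shows "hform n f \<Longrightarrow> \<exists>c. f = (\<lambda>x. \<Sum>l | length l = n. c l * prod_list (map x l))"
proof (induction rule: hform.induct)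
  case (hform_const c)
  show ?case by (rule exI[of _ "\<lambda>_. c"]) simp
next
  case (hform_zero n)
  show ?case by (rule exI[of _ "\<lambda>_. 0"]) simp
next
  case (hform_add n f g)
  then obtain c c' where
    "f = (\<lambda>x. \<Sum>l | length l = n. c l * prod_list (map x l))"
    "g = (\<lambda>x. \<Sum>l | length l = n. c' l * prod_list (map x l))" by auto
  then show ?case
    by (intro exI[of _ "\<lambda>l. c l + c' l"]) (simp add: distrib_right sum.distrib)
next
  case (hform_times_var n f i)
  then obtain c where f: "f = (\<lambda>x. \<Sum>l | length l = n. c l * prod_list (map x l))" by auto
  \<comment> \<open>Multiplication by the variable \<open>i\<close> puts \<open>i\<close> in front
    of every word; all other words get coefficient 0.\<close>
  define c' where "c' = (\<lambda>l. if hd l = i then c (tl l) else 0)"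
  have "(\<Sum>l | length l = Suc n. c' l * prod_list (map x l)) = x i * f x" for x
  proof -
    have "(\<Sum>l | length l = Suc n. c' l * prod_list (map x l)) =
      (\<Sum>l\<in>(#) i ` {l. length l = n}. c' l * prod_list (map x l))"
      by (rule sum.mono_neutral_right[OF finite_lists_length])
        (auto simp: c'_def image_iff length_Suc_conv)
    also have "\<dots> = x i * f x"
      by (subst sum.reindex) (auto simp: c'_def f sum_distrib_left mult.left_commute)
    finally show ?thesis .
  qed
  then show ?case by (intro exI[of _ c']) (simp add: fun_eq_iff)
qed

section \<open>The projective Nullstellensatz\<close>

text \<open>The degree belongs to the element because a function need not determine it: the zero
  function is a form of every degree.\<close>

definition graded_ideal :: "(nat \<times> (('i::finite \<Rightarrow> 'a::field) \<Rightarrow> 'a)) set \<Rightarrow> bool" where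
  "graded_ideal J \<longleftrightarrow> (\<forall>(n, f)\<in>J. hform n f) \<and> (\<forall>n. (n, \<lambda>_. 0) \<in> J) \<and>
     (\<forall>n f g. (n, f) \<in> J \<longrightarrow> (n, g) \<in> J \<longrightarrow> (n, \<lambda>x. f x + g x) \<in> J) \<and>
     (\<forall>m n u f. hform m u \<longrightarrow> (n, f) \<in> J \<longrightarrow> (m + n, \<lambda>x. u x * f x) \<in> J)"

lemma graded_idealI:
  assumes "\<And>n f. (n, f) \<in> J \<Longrightarrow> hform n f" "\<And>n. (n, \<lambda>_. 0) \<in> J"
    "\<And>n f g. (n, f) \<in> J \<Longrightarrow> (n, g) \<in> J \<Longrightarrow> (n, \<lambda>x. f x + g x) \<in> J"
    "\<And>m n u f. hform m u \<Longrightarrow> (n, f) \<in> J \<Longrightarrow> (m + n, \<lambda>x. u x * f x) \<in> J"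
  shows "graded_ideal J"
  using assms unfolding graded_ideal_def by blast

context
  fixes J :: "(nat \<times> (('i::finite \<Rightarrow> 'a::field) \<Rightarrow> 'a)) set"
  assumes J: "graded_ideal J"
begin

lemma ideal_hform: "(n, f) \<in> J \<Longrightarrow> hform n f"
  and ideal_zero: "(n, \<lambda>_. 0) \<in> J"
  and ideal_add: "(n, f) \<in> J \<Longrightarrow> (n, g) \<in> J \<Longrightarrow> (n, \<lambda>x. f x + g x) \<in> J"
  and ideal_mult: "hform m u \<Longrightarrow> (n, f) \<in> J \<Longrightarrow> (m + n, \<lambda>x. u x * f x) \<in> J"
  using J unfolding graded_ideal_def by blast+

lemma ideal_scale: "(n, f) \<in> J \<Longrightarrow> (n, \<lambda>x. c * f x) \<in> J"
  using ideal_mult[OF hform_const[of c]] by simp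

lemma ideal_diff: "(n, f) \<in> J \<Longrightarrow> (n, g) \<in> J \<Longrightarrow> (n, \<lambda>x. f x - g x) \<in> J"
  using ideal_add[of n f "\<lambda>x. -1 * g x"] ideal_scale[of n g "-1"] by simp

lemma ideal_sum: "(\<And>a. a \<in> A \<Longrightarrow> (n, f a) \<in> J) \<Longrightarrow> (n, \<lambda>x. \<Sum>a\<in>A. f a x) \<in> J"
  by (induction A rule: infinite_finite_induct) (auto intro: ideal_zero ideal_add)

text \<open>Every word of length \<open>m + n\<close> is a word of length \<open>m\<close> followed
  by one of length \<open>n\<close>, so products of forms span all forms of degree
  \<open>m + n\<close>.\<close>

lemma ideal_split:
  assumes "\<And>u v. hform m u \<Longrightarrow> hform n v \<Longrightarrow> (m + n, \<lambda>x. u x * v x) \<in> J"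
    and "hform (m + n) f"
  shows "(m + n, f) \<in> J"
proof -
  obtain c where f: "f = (\<lambda>x. \<Sum>l | length l = m + n. c l * prod_list (map x l))"
    using hform_monomials[OF assms(2)] by auto
  have "(m + n, \<lambda>x. c l * prod_list (map x l)) \<in> J" if "length l = m + n" for l
  proof (rule ideal_scale)
    have eq: "prod_list (map x l) = prod_list (map x (take m l)) * prod_list (map x (drop m l))"
      for x :: "'i \<Rightarrow> 'a"
      unfolding take_map[symmetric] drop_map[symmetric] prod_list.append[symmetric]
        append_take_drop_id ..
    show "(m + n, \<lambda>x. prod_list (map x l)) \<in> J"
      unfolding eq using hform_prod_list[of "take m l"] hform_prod_list[of "drop m l"] that
      by (intro assms(1)) auto
  qed
  then show ?thesis unfolding f by (intro ideal_sum) auto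
qed

lemma ideal_upward:
  assumes "\<And>f. hform n f \<Longrightarrow> (n, f) \<in> J" "n \<le> m" "hform m f"
  shows "(m, f) \<in> J"
proof -
  have "((m - n) + n, f) \<in> J"
  proof (rule ideal_split)
    show "((m - n) + n, \<lambda>x. u x * v x) \<in> J" if "hform (m - n) u" "hform n v" for u v
      using ideal_mult[OF that(1) assms(1)[OF that(2)]] .
  qed (use assms in simp)
  then show ?thesis using assms by simp
qed

end

definition cofactor :: "nat \<Rightarrow> nat \<Rightarrow> (('v \<Rightarrow> 'a::field) \<Rightarrow> 'a) \<Rightarrow> bool" where
  "cofactor a n u \<longleftrightarrow> (if a \<le> n then hform (n - a) u else u = (\<lambda>_. 0))"

text \<open>The graded ideal J + (g), with \<open>g\<close> placed in degree
  \<open>a\<close>.\<close>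

definition adjoin ::
  "(nat \<times> (('v \<Rightarrow> 'a::field) \<Rightarrow> 'a)) set \<Rightarrow> nat \<Rightarrow> (('v \<Rightarrow> 'a) \<Rightarrow> 'a) \<Rightarrow> (nat \<times> (('v \<Rightarrow> 'a) \<Rightarrow> 'a)) set"
  where "adjoin J a g = {(n, f). \<exists>j u. (n, j) \<in> J \<and> cofactor a n u \<and> f = (\<lambda>x. j x + u x * g x)}"

lemma adjoinI:
  "(n, j) \<in> J \<Longrightarrow> cofactor a n u \<Longrightarrow> (n, \<lambda>x. j x + u x * g x) \<in> adjoin J a g"
  by (auto simp: adjoin_def)

lemma cofactor_zero: "cofactor a n (\<lambda>_. 0)"
  by (auto simp: cofactor_def intro: hform_zero)

lemma graded_ideal_adjoin:
  fixes J :: "(nat \<times> (('i::finite \<Rightarrow> 'a::field) \<Rightarrow> 'a)) set"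
  assumes J: "graded_ideal J" and g: "hform a g"
  shows "graded_ideal (adjoin J a g)"
proof (rule graded_idealI)
  fix n f assume "(n, f) \<in> adjoin J a g"
  then obtain j u where ju: "(n, j) \<in> J" "cofactor a n u" "f = (\<lambda>x. j x + u x * g x)"
    by (auto simp: adjoin_def)
  have "hform n (\<lambda>x. u x * g x)"
    using ju(2) hform_mult[OF _ g, of "n - a" u]
    by (auto simp: cofactor_def hform_zero split: if_splits)
  then show "hform n f" using ju ideal_hform[OF J] by (auto intro: hform_add)
next
  fix n show "(n, \<lambda>_. 0) \<in> adjoin J a g"
    using adjoinI[OF ideal_zero[OF J] cofactor_zero, where g = g] by simp
next
  fix n f f' assume "(n, f) \<in> adjoin J a g" "(n, f') \<in> adjoin J a g"
  then obtain j u j' u' where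
    ju: "(n, j) \<in> J" "cofactor a n u" "f = (\<lambda>x. j x + u x * g x)"
    "(n, j') \<in> J" "cofactor a n u'" "f' = (\<lambda>x. j' x + u' x * g x)"
    by (auto simp: adjoin_def)
  have "cofactor a n (\<lambda>x. u x + u' x)"
    using ju by (auto simp: cofactor_def hform_add split: if_splits)
  from adjoinI[OF ideal_add[OF J ju(1,4)] this, of g] show "(n, \<lambda>x. f x + f' x) \<in> adjoin J a g"
    by (simp add: ju algebra_simps)
next
  fix m n and w f :: "('i \<Rightarrow> 'a) \<Rightarrow> 'a" assume w: "hform m w" and "(n, f) \<in> adjoin J a g"
  then obtain j u where ju: "(n, j) \<in> J" "cofactor a n u" "f = (\<lambda>x. j x + u x * g x)"
    by (auto simp: adjoin_def)
  have "cofactor a (m + n) (\<lambda>x. w x * u x)"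
    using ju(2) hform_mult[OF w, of "n - a" u] by (auto simp: cofactor_def hform_zero split: if_splits)
  from adjoinI[OF ideal_mult[OF J w ju(1)] this, of g]
  show "(m + n, \<lambda>x. w x * f x) \<in> adjoin J a g"
    by (simp add: ju algebra_simps)
qed

lemma subset_adjoin: "J \<subseteq> adjoin J a g"
  using adjoinI[OF _ cofactor_zero] by fastforce

lemma generator_in_adjoin:
  assumes "graded_ideal J"
  shows "(a, g) \<in> adjoin J a g"
  using adjoinI[OF ideal_zero[OF assms], of a a "\<lambda>_. 1" g] by (simp add: cofactor_def hform_const)

text \<open>\<open>J\<close> contains no power of the irrelevant ideal.\<close>

definition relevant :: "(nat \<times> (('i::finite \<Rightarrow> 'a::field) \<Rightarrow> 'a)) set \<Rightarrow> bool" where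
  "relevant J \<longleftrightarrow> (\<forall>n. \<exists>f. hform n f \<and> (n, f) \<notin> J)"

section \<open>Maximal relevant ideals\<close>

definition maximal_relevant :: "(nat \<times> (('i::finite \<Rightarrow> 'a::field) \<Rightarrow> 'a)) set \<Rightarrow> bool" where
  "maximal_relevant J \<longleftrightarrow> graded_ideal J \<and> relevant J \<and>
     (\<forall>J'. graded_ideal J' \<longrightarrow> relevant J' \<longrightarrow> J \<subseteq> J' \<longrightarrow> J' = J)"

text \<open>Zorn's lemma. The union of a chain stays relevant because finitely many monomials span
  the forms of degree \<open>n\<close>: if all of them were in the union, one member of the chain
  would contain them and hence every form of degree \<open>n\<close>.\<close>

lemma ex_maximal_relevant_ideal:
  fixes J0 :: "(nat \<times> (('i::finite \<Rightarrow> 'a::field) \<Rightarrow> 'a)) set"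
  assumes "graded_ideal J0" "relevant J0"
  obtains J where "maximal_relevant J" "J0 \<subseteq> J"
proof -
  define \<A> where "\<A> = {J. graded_ideal J \<and> relevant J \<and> J0 \<subseteq> J}"
  have "\<Union>\<C> \<in> \<A>" if "\<C> \<noteq> {}" and chain: "subset.chain \<A> \<C>" for \<C>
  proof -
    have C: "graded_ideal J" "relevant J" "J0 \<subseteq> J" if "J \<in> \<C>" for J
      using chain that by (auto simp: subset_chain_def \<A>_def)
    have tot: "J \<subseteq> J' \<or> J' \<subseteq> J" if "J \<in> \<C>" "J' \<in> \<C>" for J J'
      using chain that by (auto simp: subset_chain_def)
    have "graded_ideal (\<Union>\<C>)"
    proof (rule graded_idealI)
      fix n f g assume "(n, f) \<in> \<Union>\<C>" "(n, g) \<in> \<Union>\<C>"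
      then obtain J J' where "J \<in> \<C>" "J' \<in> \<C>" "(n, f) \<in> J" "(n, g) \<in> J'" by auto
      then show "(n, \<lambda>x. f x + g x) \<in> \<Union>\<C>"
        using tot[of J J'] C(1) by (blast intro: ideal_add)
    qed (use C(1) \<open>\<C> \<noteq> {}\<close> in \<open>blast intro: ideal_hform ideal_zero ideal_mult\<close>)+
    moreover have "relevant (\<Union>\<C>)"
      unfolding relevant_def
    proof (rule allI, rule ccontr)
      fix n assume "\<not> (\<exists>f. hform n f \<and> (n, f) \<notin> \<Union>\<C>)"
      then have *: "(n, \<lambda>x. prod_list (map x l)) \<in> \<Union>\<C>" if "length l = n" for l
        using hform_prod_list[of l] that by auto
      have "\<exists>J\<in>\<C>. \<forall>l\<in>S. (n, \<lambda>x. prod_list (map x l)) \<in> J"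
        if "finite S" "S \<subseteq> {l. length l = n}" for S
        using that
      proof (induction S rule: finite_induct)
        case empty
        then show ?case using \<open>\<C> \<noteq> {}\<close> by auto
      next
        case (insert l S)
        then obtain J where J: "J \<in> \<C>" "\<forall>l\<in>S. (n, \<lambda>x. prod_list (map x l)) \<in> J" by auto
        obtain J' where J': "J' \<in> \<C>" "(n, \<lambda>x. prod_list (map x l)) \<in> J'"
          using *[of l] insert.prems by auto
        show ?case
        proof (cases "J \<subseteq> J'")
          case True
          then show ?thesis using J J' by (intro bexI[of _ J']) auto
        next
          case False
          then show ?thesis using tot[OF J(1) J'(1)] J J' by (intro bexI[of _ J]) auto
        qed
      qed
      from this[OF finite_lists_length subset_refl] obtain J where
        J: "J \<in> \<C>" "\<And>l. length l = n \<Longrightarrow> (n, \<lambda>x. prod_list (map x l)) \<in> J" by auto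
      have "(n, f) \<in> J" if f: "hform n f" for f
      proof -
        obtain c where "f = (\<lambda>x. \<Sum>l | length l = n. c l * prod_list (map x l))"
          using hform_monomials[OF f] by auto
        then show ?thesis
          using J by (auto intro!: ideal_sum[OF C(1)] ideal_scale[OF C(1)])
      qed
      then show False using C(2)[OF J(1)] by (auto simp: relevant_def)
    qed
    moreover have "J0 \<subseteq> \<Union>\<C>" using C(3) \<open>\<C> \<noteq> {}\<close> by blast
    ultimately show ?thesis by (auto simp: \<A>_def)
  qed
  moreover have "\<A> \<noteq> {}" using assms by (auto simp: \<A>_def)
  ultimately have "\<exists>J\<in>\<A>. \<forall>J'\<in>\<A>. J \<subseteq> J' \<longrightarrow> J' = J" by (intro subset_Zorn_nonempty)
  then obtain J where "J \<in> \<A>" and J: "\<And>J'. J' \<in> \<A> \<Longrightarrow> J \<subseteq> J' \<Longrightarrow> J' = J" by blast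
  then have "graded_ideal J" "relevant J" "J0 \<subseteq> J" by (auto simp: \<A>_def)
  moreover have "\<forall>J'. graded_ideal J' \<longrightarrow> relevant J' \<longrightarrow> J \<subseteq> J' \<longrightarrow> J' = J"
    using J \<open>J0 \<subseteq> J\<close> by (auto simp: \<A>_def)
  ultimately show ?thesis using that by (auto simp: maximal_relevant_def)
qed

text \<open>
  Since \<open>(J + (f)) (J + (g)) \<subseteq> J + (fg)\<close>, a maximal relevant ideal is prime. Modulo such an ideal \<open>J\<close>
  all forms of large degree are multiples of a variable \<open>X\<^sub>i \<notin> J\<close>, so the homogeneous components have
  bounded dimension and there is a binary form in \<open>X\<^sub>i, X\<^sub>j\<close> which is in \<open>J\<close>. It splits into linear
  factors, one of which is in \<open>J\<close>.
\<close>

context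
  fixes J :: "(nat \<times> (('i::finite \<Rightarrow> 'a::field) \<Rightarrow> 'a)) set"
  assumes maximal: "maximal_relevant J"
begin

lemma maximal_graded_ideal: "graded_ideal J"
  and maximal_is_relevant: "relevant J"
  and maximal_eq: "graded_ideal J' \<Longrightarrow> relevant J' \<Longrightarrow> J \<subseteq> J' \<Longrightarrow> J' = J"
  using maximal unfolding maximal_relevant_def by auto

text \<open>By maximality J + (g) is not relevant, so it contains all forms of some degree and, by
  \<open>ideal_upward\<close>, of all larger degrees.\<close>

lemma maximal_adjoin:
  assumes "hform a g" "(a, g) \<notin> J"
  obtains N where "\<And>n f. N \<le> n \<Longrightarrow> hform n f \<Longrightarrow> (n, f) \<in> adjoin J a g"
proof -
  have "\<not> relevant (adjoin J a g)"
    using maximal_eq[OF graded_ideal_adjoin[OF maximal_graded_ideal assms(1)] _ subset_adjoin]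
      generator_in_adjoin[OF maximal_graded_ideal, of a g] assms(2) by metis
  then obtain N where "\<And>f. hform N f \<Longrightarrow> (N, f) \<in> adjoin J a g"
    by (auto simp: relevant_def)
  then show ?thesis
    using that ideal_upward[OF graded_ideal_adjoin[OF maximal_graded_ideal assms(1)]] by blast
qed

lemma maximal_prime:
  assumes f: "hform a f" "(a, f) \<notin> J" and g: "hform b g" "(b, g) \<notin> J"
  shows "(a + b, \<lambda>x. f x * g x) \<notin> J"
proof
  assume fg: "(a + b, \<lambda>x. f x * g x) \<in> J"
  obtain M where M: "\<And>n h. M \<le> n \<Longrightarrow> hform n h \<Longrightarrow> (n, h) \<in> adjoin J a f"
    using maximal_adjoin[OF f] by blast
  obtain N where N: "\<And>n h. N \<le> n \<Longrightarrow> hform n h \<Longrightarrow> (n, h) \<in> adjoin J b g"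
    using maximal_adjoin[OF g] by blast
  \<comment> \<open>In these degrees every form lies in J + (f), respectively J + (g), and the
    cofactors of \<open>f\<close> and \<open>g\<close> have degrees \<open>M\<close> and
    \<open>N\<close>.\<close>
  define m where "m = M + a"
  define n where "n = N + b"
  have "(m + n, \<lambda>x. u x * v x) \<in> J" if u: "hform m u" and v: "hform n v" for u v
  proof -
    obtain j u' where ju: "(m, j) \<in> J" "hform M u'" "u = (\<lambda>x. j x + u' x * f x)"
      using M[of m u] u by (auto simp: adjoin_def m_def cofactor_def)
    obtain k v' where kv: "(n, k) \<in> J" "hform N v'" "v = (\<lambda>x. k x + v' x * g x)"
      using N[of n v] v by (auto simp: adjoin_def n_def cofactor_def)
    \<comment> \<open>The product \<open>u * v\<close> splits into a multiple of \<open>j\<close>, a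
      multiple of \<open>k\<close> and a multiple of \<open>f * g\<close>, each of them in
      \<open>J\<close>.\<close>
    have 1: "(m + n, \<lambda>x. v x * j x) \<in> J"
      using ideal_mult[OF maximal_graded_ideal v ju(1)] by (simp add: add.commute)
    have 2: "(m + n, \<lambda>x. (u' x * f x) * k x) \<in> J"
      using ideal_mult[OF maximal_graded_ideal hform_mult[OF ju(2) f(1)] kv(1)] by (simp add: m_def)
    have 3: "(m + n, \<lambda>x. (u' x * v' x) * (f x * g x)) \<in> J"
      using ideal_mult[OF maximal_graded_ideal hform_mult[OF ju(2) kv(2)] fg] by (simp add: m_def n_def algebra_simps)
    have "(\<lambda>x. u x * v x) = (\<lambda>x. v x * j x + (u' x * f x * k x + u' x * v' x * (f x * g x)))"
      by (simp add: ju kv algebra_simps)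
    then show ?thesis using ideal_add[OF maximal_graded_ideal 1 ideal_add[OF maximal_graded_ideal 2 3]] by simp
  qed
  then have "(m + n, h) \<in> J" if "hform (m + n) h" for h
    using ideal_split[OF maximal_graded_ideal] that by blast
  then show False using maximal_is_relevant by (auto simp: relevant_def)
qed

lemma one_notin_maximal: "(0, \<lambda>_. 1) \<notin> J"
proof
  assume "(0, \<lambda>_. 1) \<in> J"
  then have "(n, f) \<in> J" if "hform n f" for n f
    using ideal_mult[OF maximal_graded_ideal that, of 0 "\<lambda>_. 1"] by simp
  then show False using maximal_is_relevant unfolding relevant_def by blast
qed

lemma maximal_power:
  assumes "hform a f" "(a, f) \<notin> J"
  shows "(a * k, \<lambda>x. f x ^ k) \<notin> J"
proof (induction k)
  case 0
  then show ?case using one_notin_maximal by simp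
next
  case (Suc k)
  then show ?case using maximal_prime[OF assms hform_power[OF assms(1)], of k] by simp
qed

text \<open>The variables span the forms of degree 1, so if all of them were in \<open>J\<close>,
  relevance would fail in degree 1.\<close>

lemma ex_var_notin_maximal: "\<exists>i. (1, \<lambda>x. x i) \<notin> J"
proof (rule ccontr)
  assume "\<not> (\<exists>i. (1, \<lambda>x. x i) \<notin> J)"
  then have var: "(1, \<lambda>x. x i) \<in> J" for i by auto
  have "(1, f) \<in> J" if h: "hform 1 f" for f
  proof -
    obtain c where f: "f = (\<lambda>x. \<Sum>l | length l = 1. c l * prod_list (map x l))"
      using hform_monomials[OF h] by auto
    have "(1, \<lambda>x. c l * prod_list (map x l)) \<in> J" if l: "length l = 1" for l
    proof -
      obtain i where "l = [i]" using l by (cases l) auto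
      then show ?thesis using ideal_scale[OF maximal_graded_ideal var[of i], of "c l"] by simp
    qed
    then show ?thesis unfolding f by (intro ideal_sum[OF maximal_graded_ideal]) auto
  qed
  then show False using maximal_is_relevant by (auto simp: relevant_def)
qed

text \<open>From degree \<open>N\<close> on, every form is a multiple of \<open>g\<close> modulo
  \<open>J\<close>; repeated division by \<open>g\<close> lowers the degree to \<open>N\<close>.
  Hence the number of forms needed to span a degree modulo \<open>J\<close> is bounded independently
  of the degree.\<close>

lemma hform_mod_var_power:
  assumes "hform 1 g" "(1, g) \<notin> J"
  obtains N where "\<And>k f. hform (N + k) f \<Longrightarrow>
    \<exists>u. hform N u \<and> (N + k, \<lambda>x. f x - u x * g x ^ k) \<in> J"
proof -
  obtain N where N: "\<And>n f. N \<le> n \<Longrightarrow> hform n f \<Longrightarrow> (n, f) \<in> adjoin J 1 g"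
    using maximal_adjoin[OF assms] by blast
  have "\<exists>u. hform N u \<and> (N + k, \<lambda>x. f x - u x * g x ^ k) \<in> J" if "hform (N + k) f" for k f
    using that
  proof (induction k arbitrary: f)
    case 0
    then show ?case using ideal_zero[OF maximal_graded_ideal] by auto
  next
    case (Suc k)
    obtain j v where jv: "(N + Suc k, j) \<in> J" "hform (N + k) v" "f = (\<lambda>x. j x + v x * g x)"
      using N[OF _ Suc.prems] by (auto simp: adjoin_def cofactor_def)
    from Suc.IH[OF jv(2)] obtain u where
      u: "hform N u" "(N + k, \<lambda>x. v x - u x * g x ^ k) \<in> J" by auto
    have "(N + Suc k, \<lambda>x. g x * (v x - u x * g x ^ k)) \<in> J"
      using ideal_mult[OF maximal_graded_ideal assms(1) u(2)] by simp
    from ideal_add[OF maximal_graded_ideal jv(1) this] have "(N + Suc k, \<lambda>x. f x - u x * g x ^ Suc k) \<in> J"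
      by (simp add: jv(3) algebra_simps)
    then show ?case using u by blast
  qed
  then show ?thesis using that by blast
qed

lemma ex_binary_form_in_maximal:
  assumes "(1, \<lambda>x. x i) \<notin> J"
  obtains c :: "nat \<Rightarrow> 'a" and n where "\<exists>a\<le>n. c a \<noteq> 0"
    "(n, \<lambda>x. \<Sum>a\<le>n. c a * (x j ^ a * x i ^ (n - a))) \<in> J"
proof -
  obtain N where N: "\<And>k f. hform (N + k) f \<Longrightarrow>
    \<exists>u. hform N u \<and> (N + k, \<lambda>x. f x - u x * x i ^ k) \<in> J"
    using hform_mod_var_power[OF hform_var assms] by blast
  \<comment> \<open>Modulo \<open>J\<close> each of the \<open>n + 1\<close> monomials
    \<open>f a\<close> reduces to \<open>x i ^ k\<close> times a combination of \<open>k\<close>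
    monomials of degree \<open>N\<close>. Since \<open>k < n + 1\<close>, some nontrivial
    combination of the \<open>f a\<close> reduces to 0.\<close>
  define k where "k = card {l :: 'i list. length l = N}"
  define n where "n = N + k"
  define f where "f = (\<lambda>a (x :: 'i \<Rightarrow> 'a). x j ^ a * x i ^ (n - a))"
  have f: "hform n (f a)" if "a \<le> n" for a
    using hform_mult[OF hform_power[OF hform_var[of j], of a] hform_power[OF hform_var[of i], of "n - a"]]
      that by (simp add: f_def)
  have "\<exists>c. (n, \<lambda>x. f a x - (\<Sum>l | length l = N. c l * prod_list (map x l)) * x i ^ k) \<in> J"
    if a: "a \<le> n" for a
  proof -
    obtain u where u: "hform N u" "(n, \<lambda>x. f a x - u x * x i ^ k) \<in> J"
      using N[OF f[OF a, unfolded n_def]] unfolding n_def by blast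
    obtain c where "u = (\<lambda>x. \<Sum>l | length l = N. c l * prod_list (map x l))"
      using hform_monomials[OF u(1)] by blast
    then show ?thesis using u(2) by (intro exI[of _ c]) simp
  qed
  then have "\<forall>a\<in>{..n}. \<exists>c. (n, \<lambda>x. f a x - (\<Sum>l | length l = N. c l * prod_list (map x l)) * x i ^ k) \<in> J"
    by simp
  from bchoice[OF this] obtain M where M: "\<And>a. a \<le> n \<Longrightarrow>
      (n, \<lambda>x. f a x - (\<Sum>l | length l = N. M a l * prod_list (map x l)) * x i ^ k) \<in> J"
    by auto
  obtain c where c: "\<exists>a\<in>{..n}. c a \<noteq> 0"
    "\<And>l. length l = N \<Longrightarrow> (\<Sum>a\<le>n. c a * M a l) = 0"
    using underdetermined_system[OF finite_lists_length, of "{..n}" N M]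
    by (auto simp: n_def k_def)
  have "(n, \<lambda>x. \<Sum>a\<le>n. c a * (f a x - (\<Sum>l | length l = N. M a l * prod_list (map x l)) * x i ^ k)) \<in> J"
    by (intro ideal_sum[OF maximal_graded_ideal] ideal_scale[OF maximal_graded_ideal] M) auto
  moreover have "(\<Sum>a\<le>n. c a * ((\<Sum>l | length l = N. M a l * prod_list (map x l)) * x i ^ k)) = 0"
    for x
  proof -
    have "(\<Sum>a\<le>n. c a * ((\<Sum>l | length l = N. M a l * prod_list (map x l)) * x i ^ k)) =
      (\<Sum>l | length l = N. (\<Sum>a\<le>n. c a * M a l) * prod_list (map x l) * x i ^ k)"
      by (simp add: sum_distrib_left sum_distrib_right mult.assoc) (rule sum.swap)
    then show ?thesis using c(2) by simp
  qed
  ultimately have "(n, \<lambda>x. \<Sum>a\<le>n. c a * f a x) \<in> J"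
    by (simp add: right_diff_distrib sum_subtractf)
  then show ?thesis using that c(1) by (auto simp: f_def)
qed

end

text \<open>The sum on the right is the homogenisation of \<open>q\<close> to degree
  \<open>k\<close>, and the identity says that a root \<open>l\<close> homogenises to the linear
  factor \<open>y - l * z\<close>. A \<open>k\<close> above the degree of \<open>q\<close> accounts
  for additional factors \<open>z\<close>.\<close>

lemma binary_form_factor:
  fixes q :: "'a::comm_ring_1 poly"
  assumes "degree q \<le> k"
  shows "(\<Sum>a\<le>Suc k. coeff ([:- l, 1:] * q) a * (y ^ a * z ^ (Suc k - a))) =
    (y - l * z) * (\<Sum>a\<le>k. coeff q a * (y ^ a * z ^ (k - a)))"
proof -
  have c0: "coeff ([:- l, 1:] * q) 0 = - l * coeff q 0" by simp
  have cS: "coeff ([:- l, 1:] * q) (Suc b) = coeff q b - l * coeff q (Suc b)" for b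
    by simp
  have "(\<Sum>a\<le>Suc k. coeff q a * (y ^ a * z ^ (Suc k - a))) =
      (\<Sum>a\<le>k. coeff q a * (y ^ a * z ^ (Suc k - a)))"
    using assms by (simp add: coeff_eq_0)
  also have "\<dots> = z * (\<Sum>a\<le>k. coeff q a * (y ^ a * z ^ (k - a)))"
    unfolding sum_distrib_left by (intro sum.cong) (auto simp: Suc_diff_le algebra_simps)
  finally have *: "coeff q 0 * z ^ Suc k + (\<Sum>b\<le>k. coeff q (Suc b) * (y ^ Suc b * z ^ (k - b))) =
      z * (\<Sum>a\<le>k. coeff q a * (y ^ a * z ^ (k - a)))"
    by (subst (asm) sum.atMost_Suc_shift) simp
  have "(\<Sum>a\<le>Suc k. coeff ([:- l, 1:] * q) a * (y ^ a * z ^ (Suc k - a))) =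
      - l * coeff q 0 * z ^ Suc k +
      (\<Sum>b\<le>k. (coeff q b - l * coeff q (Suc b)) * (y ^ Suc b * z ^ (k - b)))"
    by (subst sum.atMost_Suc_shift) (simp only: c0 cS, simp)
  also have "\<dots> = (\<Sum>b\<le>k. coeff q b * (y ^ Suc b * z ^ (k - b))) -
      l * (coeff q 0 * z ^ Suc k + (\<Sum>b\<le>k. coeff q (Suc b) * (y ^ Suc b * z ^ (k - b))))"
    by (simp add: left_diff_distrib sum_subtractf sum_distrib_left algebra_simps)
  also have "(\<Sum>b\<le>k. coeff q b * (y ^ Suc b * z ^ (k - b))) =
      y * (\<Sum>a\<le>k. coeff q a * (y ^ a * z ^ (k - a)))"
    by (simp add: sum_distrib_left algebra_simps)
  finally show ?thesis unfolding * by (simp add: algebra_simps)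
qed

lemma ex_linear_form_in_maximal:
  fixes J :: "(nat \<times> (('i::finite \<Rightarrow> 'a::alg_closed_field) \<Rightarrow> 'a)) set"
  assumes max: "maximal_relevant J"
    and i: "(1, \<lambda>x. x i) \<notin> J"
  shows "\<exists>l. (1, \<lambda>x. x j - l * x i) \<in> J"
proof -
  have "\<exists>l. (1, \<lambda>x. x j - l * x i) \<in> J"
    if "p \<noteq> 0" "degree p \<le> k" "(k, \<lambda>x. \<Sum>a\<le>k. coeff p a * (x j ^ a * x i ^ (k - a))) \<in> J"
    for p :: "'a poly" and k
    using that
  proof (induction "degree p" arbitrary: p k)
    \<comment> \<open>A nonzero constant homogenises to a nonzero multiple of
      \<open>x i ^ k\<close>, which \<open>J\<close> does not contain, so this case is
      contradictory.\<close>
    case 0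
    then obtain c where c: "p = [:c:]" "c \<noteq> 0" by (metis degree_eq_zeroE pCons_0_0)
    have "(\<Sum>a\<le>k. coeff p a * (x j ^ a * x i ^ (k - a))) = c * x i ^ k" for x :: "'i \<Rightarrow> 'a"
    proof -
      have "(\<Sum>a\<le>k. coeff p a * (x j ^ a * x i ^ (k - a))) =
          (\<Sum>a\<in>{0}. coeff p a * (x j ^ a * x i ^ (k - a)))"
        by (rule sum.mono_neutral_right) (auto simp: c coeff_pCons split: nat.split)
      then show ?thesis by (simp add: c)
    qed
    with "0.prems" have "(k, \<lambda>x. c * x i ^ k) \<in> J" by simp
    from ideal_scale[OF maximal_graded_ideal[OF max] this, of "inverse c"] have "(k, \<lambda>x. x i ^ k) \<in> J"
      using c by (simp flip: mult.assoc)
    then show ?case using maximal_power[OF max hform_var i, of k] by simp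
  next
    case (Suc d)
    then obtain l where "poly p l = 0"
      using alg_closed_imp_poly_has_root[of p] by auto
    then obtain q where q: "p = [:- l, 1:] * q" by (metis poly_eq_0_iff_dvd dvdE)
    with Suc.prems(1) have "q \<noteq> 0" by auto
    then have d: "degree p = Suc (degree q)"
      unfolding q by (subst degree_mult_eq) auto
    with Suc.prems obtain k' where k: "k = Suc k'" "degree q \<le> k'" by (cases k) auto
    define h where "h = (\<lambda>x :: 'i \<Rightarrow> 'a. \<Sum>a\<le>k'. coeff q a * (x j ^ a * x i ^ (k' - a)))"
    have h: "hform k' h"
      unfolding h_def
    proof (intro hform_sum hform_scale)
      fix a assume "a \<in> {..k'}"
      then show "hform k' (\<lambda>x. x j ^ a * x i ^ (k' - a))"
        using hform_mult[OF hform_power[OF hform_var[of j], of a]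
            hform_power[OF hform_var[of i], of "k' - a"]] by simp
    qed
    have lin: "hform 1 (\<lambda>x. x j - l * x i)"
      by (intro hform_diff hform_scale hform_var)
    have "(1 + k', \<lambda>x. (x j - l * x i) * h x) \<in> J"
      using Suc.prems(3) unfolding k(1) q h_def binary_form_factor[OF k(2)] by simp
    then consider "(1, \<lambda>x. x j - l * x i) \<in> J" | "(k', h) \<in> J"
      \<comment> \<open>Either the linear factor is in \<open>J\<close>, or the cofactor is and the
        induction continues with \<open>q\<close>.\<close>
      using maximal_prime[OF max lin _ h] by blast
    then show ?case
    proof cases
      case 2
      then show ?thesis using Suc.hyps(1)[of q k'] Suc.hyps(2) d k \<open>q \<noteq> 0\<close> by (simp add: h_def)
    qed auto
  qed
  moreover obtain c :: "nat \<Rightarrow> 'a" and n where c: "\<exists>a\<le>n. c a \<noteq> 0"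
    "(n, \<lambda>x. \<Sum>a\<le>n. c a * (x j ^ a * x i ^ (n - a))) \<in> J"
    by (rule ex_binary_form_in_maximal[OF max i, of j])
  define p where "p = (\<Sum>a\<le>n. monom (c a) a)"
  have coeff: "coeff p a = (if a \<le> n then c a else 0)" for a
    by (auto simp: p_def coeff_sum)
  have "p \<noteq> 0" using c(1) coeff by (metis coeff_0)
  moreover have "degree p \<le> n" by (rule degree_le) (simp add: coeff)
  moreover have "(\<Sum>a\<le>n. coeff p a * (x j ^ a * x i ^ (n - a))) =
      (\<Sum>a\<le>n. c a * (x j ^ a * x i ^ (n - a)))" for x
    by (intro sum.cong) (auto simp: coeff)
  ultimately show ?thesis using c(2) by simp
qed

text \<open>In a maximal relevant \<open>M\<close> above \<open>J\<close> every variable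
  \<open>j\<close> is congruent to \<open>l j\<close> times the variable \<open>i\<close>, so a form
  \<open>f\<close> of degree \<open>n\<close> is congruent to \<open>f l * x i ^ n\<close>. If
  \<open>f\<close> is in \<open>M\<close>, then \<open>f l\<close> must vanish, since no power of
  the variable \<open>i\<close> is in \<open>M\<close>. So \<open>l\<close> is the required
  zero.\<close>

theorem projective_nullstellensatz:
  fixes J :: "(nat \<times> (('i::finite \<Rightarrow> 'a::alg_closed_field) \<Rightarrow> 'a)) set"
  assumes "graded_ideal J" "relevant J"
  obtains x where "x \<noteq> (\<lambda>_. 0)" "\<And>n f. (n, f) \<in> J \<Longrightarrow> f x = 0"
proof -
  obtain M where max: "maximal_relevant M" and "J \<subseteq> M"
    using ex_maximal_relevant_ideal[OF assms] by blast
  note M = maximal_graded_ideal[OF max]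
  obtain i where i: "(1, \<lambda>x. x i) \<notin> M" using ex_var_notin_maximal[OF max] by blast
  have "\<forall>j. \<exists>l. (1, \<lambda>x. x j - l * x i) \<in> M"
    using ex_linear_form_in_maximal[OF max i] by simp
  from choice[OF this] obtain l where l: "(1, \<lambda>x. x j - l j * x i) \<in> M" for j by auto
  \<comment> \<open>Otherwise the variable \<open>i\<close> would be a scalar multiple of
    \<open>x i - l i * x i\<close> and so lie in \<open>M\<close>. The equation shows that
    \<open>l\<close> is not the zero vector.\<close>
  have li: "l i = 1"
  proof (rule ccontr)
    assume "l i \<noteq> 1"
    then have "inverse (1 - l i) * (x i - l i * x i) = x i" for x :: "'i \<Rightarrow> 'a"
      using left_inverse[of "1 - l i"] by (simp add: left_diff_distrib[of 1 "l i", simplified, symmetric]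
          flip: mult.assoc)
    then show False using i ideal_scale[OF M l[of i], of "inverse (1 - l i)"] by simp
  qed
  have red: "(n, \<lambda>x. f x - f l * x i ^ n) \<in> M" if "hform n f" for n f
    using that
  proof (induction rule: hform.induct)
    case (hform_add n f g)
    then show ?case using ideal_add[OF M hform_add.IH] by (simp add: algebra_simps)
  next
    case (hform_times_var n f j)
    have 1: "(Suc n, \<lambda>x. x j * (f x - f l * x i ^ n)) \<in> M"
      using ideal_mult[OF M hform_var hform_times_var.IH] by simp
    have 2: "(Suc n, \<lambda>x. f l * x i ^ n * (x j - l j * x i)) \<in> M"
      using ideal_mult[OF M hform_scale[OF hform_power[OF hform_var[of i], of n], of "f l"] l[of j]] by simp
    show ?case using ideal_add[OF M 1 2] by (simp add: algebra_simps)
  qed (use ideal_zero[OF M] in auto)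
  have "f l = 0" if "(n, f) \<in> J" for n f
  proof (rule ccontr)
    assume "f l \<noteq> 0"
    have f: "(n, f) \<in> M" using that \<open>J \<subseteq> M\<close> by auto
    have "(n, \<lambda>x. inverse (f l) * (f x - (f x - f l * x i ^ n))) \<in> M"
      by (intro ideal_scale[OF M] ideal_diff[OF M] f red ideal_hform[OF M f])
    then have "(n, \<lambda>x. x i ^ n) \<in> M" using \<open>f l \<noteq> 0\<close> by (simp flip: mult.assoc)
    then show False using maximal_power[OF max hform_var i, of n] by simp
  qed
  moreover have "l \<noteq> (\<lambda>_. 0)" using li by auto
  ultimately show ?thesis using that by blast
qed

section \<open>Hilbert functions and dimension\<close>

definition vanishing_ideal :: "('i \<Rightarrow> 'a::field) set \<Rightarrow> (nat \<times> (('i \<Rightarrow> 'a) \<Rightarrow> 'a)) set" where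
  "vanishing_ideal C = {(n, f). hform n f \<and> (\<forall>x\<in>C. f x = 0)}"

lemma graded_ideal_vanishing_ideal: "graded_ideal (vanishing_ideal (C :: ('i::finite \<Rightarrow> 'a::field) set))"
  by (rule graded_idealI) (auto simp: vanishing_ideal_def intro: hform_zero hform_add hform_mult)

text \<open>Bounds the Hilbert function of \<open>J\<close> in degree \<open>n\<close> from above by
  \<open>m\<close>. A relation is enough, since only estimates are compared.\<close>

definition span_dim :: "(nat \<times> (('i::finite \<Rightarrow> 'a::field) \<Rightarrow> 'a)) set \<Rightarrow> nat \<Rightarrow> nat \<Rightarrow> bool" where
  "span_dim J n m \<longleftrightarrow> (\<exists>B. finite B \<and> card B \<le> m \<and>
     (\<forall>f. hform n f \<longrightarrow> (\<exists>c. (n, \<lambda>x. f x - (\<Sum>b\<in>B. c b * b x)) \<in> J)))"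

lemma span_dim_mono: "span_dim J n m \<Longrightarrow> m \<le> m' \<Longrightarrow> J \<subseteq> J' \<Longrightarrow> span_dim J' n m'"
  unfolding span_dim_def by (meson order_trans subsetD)

lemma sum_superset_coeff:
  fixes c :: "('x \<Rightarrow> 'a::field) \<Rightarrow> 'a"
  assumes "B \<subseteq> B'" "finite B'"
  shows "\<exists>c'. \<forall>x. (\<Sum>b\<in>B. c b * b x) = (\<Sum>b\<in>B'. c' b * b x)"
proof (intro exI allI)
  fix x
  show "(\<Sum>b\<in>B. c b * b x) = (\<Sum>b\<in>B'. (if b \<in> B then c b else 0) * b x)"
    using assms by (intro sum.mono_neutral_cong_left) auto
qed

lemma sum_image_coeff:
  fixes c :: "'u \<Rightarrow> 'a::field" and h :: "'u \<Rightarrow> 'x \<Rightarrow> 'a"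
  assumes "finite B"
  shows "\<exists>c'. \<forall>x. (\<Sum>b\<in>B. c b * h b x) = (\<Sum>y\<in>h ` B. c' y * y x)"
proof (intro exI allI)
  fix x
  show "(\<Sum>b\<in>B. c b * h b x) = (\<Sum>y\<in>h ` B. (\<Sum>b | b \<in> B \<and> h b = y. c b) * y x)"
    by (subst sum.image_gen[OF assms, of _ h]) (auto simp: sum_distrib_right intro!: sum.cong)
qed

lemma ex_span_dim:
  assumes "graded_ideal J"
  shows "\<exists>m. span_dim J n m"
proof -
  define h where "h = (\<lambda>l (x :: 'a \<Rightarrow> 'b). prod_list (map x l))"
  define B where "B = h ` {l. length l = n}"
  have "\<exists>c. (n, \<lambda>x. f x - (\<Sum>b\<in>B. c b * b x)) \<in> J" if f: "hform n f" for f
  proof -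
    obtain c where "f = (\<lambda>x. \<Sum>l | length l = n. c l * h l x)"
      using hform_monomials[OF f] by (auto simp: h_def)
    with sum_image_coeff[OF finite_lists_length[of n], of c h] obtain c' where
      "f = (\<lambda>x. \<Sum>b\<in>B. c' b * b x)" by (auto simp: B_def)
    then show ?thesis using ideal_zero[OF assms, of n] by (intro exI[of _ c']) simp
  qed
  moreover have "finite B" by (simp add: B_def finite_lists_length)
  ultimately show ?thesis unfolding span_dim_def by blast
qed

text \<open>Modulo \<open>J\<close>, a form of degree \<open>n\<close> is a combination of spanning
  elements for J + (g) plus a multiple of \<open>g\<close>, whose cofactor is a form of degree
  \<open>n - a\<close>. Multiplying spanning elements of that degree by \<open>g\<close> supplies
  the missing ones.\<close>

lemma span_dim_adjoin:
  assumes J: "graded_ideal J" and g: "hform a g" and "a \<le> n"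
    and 1: "span_dim (adjoin J a g) n m" and 2: "span_dim J (n - a) m'"
  shows "span_dim J n (m + m')"
proof -
  obtain B where B: "finite B" "card B \<le> m"
    "\<And>f. hform n f \<Longrightarrow> \<exists>c. (n, \<lambda>x. f x - (\<Sum>b\<in>B. c b * b x)) \<in> adjoin J a g"
    using 1 by (auto simp: span_dim_def)
  obtain B' where B': "finite B'" "card B' \<le> m'"
    "\<And>f. hform (n - a) f \<Longrightarrow> \<exists>c. (n - a, \<lambda>x. f x - (\<Sum>b\<in>B'. c b * b x)) \<in> J"
    using 2 by (auto simp: span_dim_def)
  define h where "h = (\<lambda>(b :: ('a \<Rightarrow> 'b) \<Rightarrow> 'b) x. g x * b x)"
  define D where "D = B \<union> h ` B'"
  have D: "finite D" "B \<subseteq> D" "h ` B' \<subseteq> D" using B B' by (auto simp: D_def)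
  have "card D \<le> m + m'"
    using card_Un_le[of B "h ` B'"] card_image_le[OF B'(1), of h] B(2) B'(2) by (simp add: D_def)
  moreover have "\<exists>c. (n, \<lambda>x. f x - (\<Sum>b\<in>D. c b * b x)) \<in> J" if f: "hform n f" for f
  proof -
    obtain c where "(n, \<lambda>x. f x - (\<Sum>b\<in>B. c b * b x)) \<in> adjoin J a g" using B(3)[OF f] by auto
    then obtain j u where j: "(n, j) \<in> J" and u: "hform (n - a) u"
      and eq: "\<And>x. f x - (\<Sum>b\<in>B. c b * b x) = j x + u x * g x"
      using \<open>a \<le> n\<close> by (auto simp: adjoin_def cofactor_def fun_eq_iff)
    obtain c' where c': "(n - a, \<lambda>x. u x - (\<Sum>b\<in>B'. c' b * b x)) \<in> J" using B'(3)[OF u] by auto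
    have *: "(n, \<lambda>x. j x + g x * (u x - (\<Sum>b\<in>B'. c' b * b x))) \<in> J"
      using ideal_add[OF J j] ideal_mult[OF J g c'] \<open>a \<le> n\<close> by simp
    obtain c1 where c1: "\<And>x. (\<Sum>b\<in>B. c b * b x) = (\<Sum>b\<in>D. c1 b * b x)"
      using sum_superset_coeff[OF D(2,1), of c] by blast
    obtain c2 where c2: "\<And>x. (\<Sum>b\<in>B'. c' b * h b x) = (\<Sum>b\<in>h ` B'. c2 b * b x)"
      using sum_image_coeff[OF B'(1), of c' h] by blast
    obtain c3 where c3: "\<And>x. (\<Sum>b\<in>h ` B'. c2 b * b x) = (\<Sum>b\<in>D. c3 b * b x)"
      using sum_superset_coeff[OF D(3,1), of c2] by blast
    have "j x + g x * (u x - (\<Sum>b\<in>B'. c' b * b x)) = f x - (\<Sum>b\<in>D. (c1 b + c3 b) * b x)" for x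
    proof -
      have "g x * (\<Sum>b\<in>B'. c' b * b x) = (\<Sum>b\<in>D. c3 b * b x)"
        unfolding c3[symmetric] c2[symmetric] by (simp add: h_def sum_distrib_left mult.left_commute)
      then have "(\<Sum>b\<in>D. (c1 b + c3 b) * b x) = (\<Sum>b\<in>B. c b * b x) + g x * (\<Sum>b\<in>B'. c' b * b x)"
        by (simp only: c1 distrib_right sum.distrib)
      moreover have "f x = j x + u x * g x + (\<Sum>b\<in>B. c b * b x)"
        using eq[of x] by (simp add: diff_eq_eq)
      ultimately show ?thesis by (simp only: right_diff_distrib mult.commute[of "u x"]) simp
    qed
    with * show ?thesis by (intro exI[of _ "\<lambda>b. c1 b + c3 b"]) simp
  qed
  ultimately show ?thesis using D(1) unfolding span_dim_def by blast
qed

lemma span_dim_adjoin_less: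
  assumes "n < a" "span_dim (adjoin J a g) n m"
  shows "span_dim J n m"
  using assms by (auto simp: span_dim_def adjoin_def cofactor_def)

text \<open>The Hilbert function of \<open>J\<close> is bounded by a polynomial of degree \<open>k - 1\<close>, where degree \<open>-1\<close>
  means that it vanishes eventually.\<close>

definition growth_at_most :: "(nat \<times> (('i::finite \<Rightarrow> 'a::field) \<Rightarrow> 'a)) set \<Rightarrow> nat \<Rightarrow> bool" where
  "growth_at_most J k \<longleftrightarrow> (case k of
      0 \<Rightarrow> \<exists>N. \<forall>n\<ge>N. span_dim J n 0
    | Suc l \<Rightarrow> \<exists>C. \<forall>n. span_dim J n (C * (n + 1) ^ l))"

text \<open>Iterating \<open>span_dim_adjoin\<close> adds up the bounds for J + (g) in degrees n, n
  - a, n - 2a and so on; such a sum of values of a polynomial grows by at most one degree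
  more.\<close>

lemma growth_at_most_adjoin:
  assumes J: "graded_ideal J" and g: "hform a g" "a > 0"
    and gr: "growth_at_most (adjoin J a g) k"
  shows "growth_at_most J (Suc k)"
proof (cases k)
  case 0
  with gr obtain N where N: "\<And>n. n \<ge> N \<Longrightarrow> span_dim (adjoin J a g) n 0"
    by (auto simp: growth_at_most_def)
  obtain m where m: "\<And>n. span_dim J n (m n)" using ex_span_dim[OF J] by metis
  \<comment> \<open>From degree \<open>N\<close> on J + (g) contributes nothing, so the bound in
    degree \<open>n\<close> is inherited from degree \<open>n - a\<close>; \<open>C\<close> covers
    the finitely many degrees below \<open>N\<close>.\<close>
  define C where "C = (\<Sum>n<N. m n)"
  have "span_dim J n C" for n
  proof (induction n rule: less_induct)
    case (less n)
    consider "n < N" | "n \<ge> N" "n < a" | "n \<ge> N" "a \<le> n" by linarith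
    then show ?case
    proof cases
      case 1
      then have "m n \<le> C" unfolding C_def by (intro member_le_sum) auto
      then show ?thesis using span_dim_mono[OF m] by blast
    next
      case 2
      then show ?thesis using span_dim_mono[OF span_dim_adjoin_less[OF _ N]] by blast
    next
      case 3
      then show ?thesis
        using span_dim_adjoin[OF J g(1) _ N less.IH[of "n - a"]] g(2) by simp
    qed
  qed
  then show ?thesis unfolding 0 growth_at_most_def by (auto intro: exI[of _ C])
next
  case (Suc l)
  with gr obtain C where C: "\<And>n. span_dim (adjoin J a g) n (C * (n + 1) ^ l)"
    by (auto simp: growth_at_most_def)
  have "span_dim J n (C * (n + 1) ^ Suc l)" for n
  proof (induction n rule: less_induct)
    case (less n)
    show ?case
    proof (cases "n < a")
      case True
      then show ?thesis
        using span_dim_mono[OF span_dim_adjoin_less[OF _ C], of n "C * (n + 1) ^ Suc l"] by simp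
    next
      case False
      then have "a \<le> n" by simp
      \<comment> \<open>As \<open>a > 0\<close>, \<open>n - a + 1\<close> is at most
        \<open>n\<close>. This leaves room for exactly one summand \<open>C * (n + 1) ^ l\<close> in
        the induction.\<close>
      have "(n - a + 1) ^ Suc l \<le> n * (n + 1) ^ l"
        using g(2) False unfolding power_Suc by (intro mult_mono power_mono) auto
      then have "C * (n + 1) ^ l + C * (n - a + 1) ^ Suc l \<le> C * (n + 1) ^ l + C * (n * (n + 1) ^ l)"
        using mult_le_mono2 by (intro add_left_mono) blast
      also have "\<dots> = C * (n + 1) ^ Suc l" by (simp add: algebra_simps)
      finally show ?thesis
        using span_dim_mono[OF span_dim_adjoin[OF J g(1) \<open>a \<le> n\<close> C less.IH[of "n - a"]]] g(2) \<open>a \<le> n\<close>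
        by simp
    qed
  qed
  then show ?thesis unfolding Suc growth_at_most_def by auto
qed

definition adjoin_all ::
  "(nat \<times> (('v \<Rightarrow> 'a::field) \<Rightarrow> 'a)) list \<Rightarrow> (nat \<times> (('v \<Rightarrow> 'a) \<Rightarrow> 'a)) set \<Rightarrow>
   (nat \<times> (('v \<Rightarrow> 'a) \<Rightarrow> 'a)) set" where
  "adjoin_all gs J = foldr (\<lambda>(a, g) J. adjoin J a g) gs J"

lemma graded_ideal_adjoin_all:
  assumes "graded_ideal J" "\<And>a g. (a, g) \<in> set gs \<Longrightarrow> hform a g"
  shows "graded_ideal (adjoin_all gs J)"
  using assms by (induction gs) (auto simp: adjoin_all_def intro: graded_ideal_adjoin)

lemma subset_adjoin_all: "J \<subseteq> adjoin_all gs J"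
  using subset_adjoin by (induction gs) (fastforce simp: adjoin_all_def)+

lemma generators_in_adjoin_all:
  assumes "graded_ideal J" "\<And>a g. (a, g) \<in> set gs \<Longrightarrow> hform a g"
  shows "set gs \<subseteq> adjoin_all gs J"
  using assms(2)
proof (induction gs)
  case (Cons p gs)
  obtain a g where p: "p = (a, g)" by force
  have "graded_ideal (adjoin_all gs J)"
    using Cons.prems by (intro graded_ideal_adjoin_all assms(1)) auto
  then have "(a, g) \<in> adjoin_all (p # gs) J"
    using generator_in_adjoin by (simp add: adjoin_all_def p)
  moreover have "set gs \<subseteq> adjoin_all gs J" using Cons by simp
  moreover have "adjoin_all gs J \<subseteq> adjoin_all (p # gs) J"
    using subset_adjoin by (simp add: adjoin_all_def p)
  ultimately show ?case by (auto simp: p)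
qed auto

lemma growth_at_most_adjoin_all:
  assumes "graded_ideal J" "\<And>a g. (a, g) \<in> set gs \<Longrightarrow> hform a g \<and> a > 0"
    and "growth_at_most (adjoin_all gs J) k"
  shows "growth_at_most J (k + length gs)"
  using assms(2,3)
proof (induction gs arbitrary: k)
  case (Cons p gs)
  obtain a g where p: "p = (a, g)" by force
  have "graded_ideal (adjoin_all gs J)"
    using Cons.prems(1) by (intro graded_ideal_adjoin_all assms(1)) auto
  then have "growth_at_most (adjoin_all gs J) (Suc k)"
    using Cons.prems by (intro growth_at_most_adjoin[of _ a g]) (auto simp: adjoin_all_def p)
  moreover have "hform b f \<and> b > 0" if "(b, f) \<in> set gs" for b f
    using Cons.prems(1)[of b f] that by simp
  ultimately show ?case using Cons.IH[of "Suc k"] by simp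
qed (simp add: adjoin_all_def)

section \<open>Lower bounds for Hilbert functions along a chain\<close>

definition independent_forms :: "('i::finite \<Rightarrow> 'a::field) set \<Rightarrow> nat \<Rightarrow> nat \<Rightarrow> bool" where
  "independent_forms C n m \<longleftrightarrow> (\<exists>v :: nat \<Rightarrow> _. (\<forall>a<m. hform n (v a)) \<and>
     (\<forall>c. (\<forall>x\<in>C. (\<Sum>a<m. c a * v a x) = 0) \<longrightarrow> (\<forall>a<m. c a = 0)))"

lemma independent_forms_le:
  assumes "independent_forms C n m" "m' \<le> m"
  shows "independent_forms C n m'"
proof -
  obtain v where v: "\<forall>a<m. hform n (v a)"
    "\<And>c. \<forall>x\<in>C. (\<Sum>a<m. c a * v a x) = 0 \<Longrightarrow> \<forall>a<m. c a = 0"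
    using assms(1) by (auto simp: independent_forms_def)
  have "\<forall>a<m'. c a = 0" if "\<forall>x\<in>C. (\<Sum>a<m'. c a * v a x) = 0" for c
  proof -
    have "(\<Sum>a<m. (if a < m' then c a else 0) * v a x) = (\<Sum>a<m'. c a * v a x)" for x
      using assms(2) by (intro sum.mono_neutral_cong_right) auto
    with v(2)[of "\<lambda>a. if a < m' then c a else 0"] that
    have "\<forall>a<m. (if a < m' then c a else 0) = 0" by simp
    then show ?thesis using assms(2) by (metis less_le_trans)
  qed
  then show ?thesis using v(1) assms(2) unfolding independent_forms_def
    by (intro exI[of _ v]) auto
qed

lemma independent_forms_le_span_dim:
  assumes "independent_forms C n m" "span_dim (vanishing_ideal C) n m'"
  shows "m \<le> m'"
proof (rule ccontr)
  assume "\<not> m \<le> m'"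
  obtain v where v: "\<And>a. a < m \<Longrightarrow> hform n (v a)"
    "\<And>c. \<forall>x\<in>C. (\<Sum>a<m. c a * v a x) = 0 \<Longrightarrow> \<forall>a<m. c a = 0"
    using assms(1) by (auto simp: independent_forms_def)
  obtain B where B: "finite B" "card B \<le> m'"
    "\<And>f. hform n f \<Longrightarrow> \<exists>c. (n, \<lambda>x. f x - (\<Sum>b\<in>B. c b * b x)) \<in> vanishing_ideal C"
    using assms(2) by (auto simp: span_dim_def)
  have "\<exists>c. \<forall>x\<in>C. v a x = (\<Sum>b\<in>B. c b * b x)" if "a < m" for a
    using B(3)[OF v(1)[OF that]] by (auto simp: vanishing_ideal_def)
  then obtain M where M: "\<And>a x. a < m \<Longrightarrow> x \<in> C \<Longrightarrow> v a x = (\<Sum>b\<in>B. M a b * b x)" by metis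
  obtain c where c: "\<exists>a\<in>{..<m}. c a \<noteq> 0" "\<And>b. b \<in> B \<Longrightarrow> (\<Sum>a<m. c a * M a b) = 0"
    using underdetermined_system[OF B(1), of "{..<m}" M] B(2) \<open>\<not> m \<le> m'\<close> by auto
  have "(\<Sum>a<m. c a * v a x) = 0" if "x \<in> C" for x
  proof -
    have "(\<Sum>a<m. c a * v a x) = (\<Sum>a<m. \<Sum>b\<in>B. c a * M a b * b x)"
      using that by (simp add: M sum_distrib_left mult.assoc)
    also have "\<dots> = (\<Sum>b\<in>B. (\<Sum>a<m. c a * M a b) * b x)"
      by (subst sum.swap) (simp add: sum_distrib_right)
    finally show ?thesis using c(2) by simp
  qed
  then show False using v(2)[of c] c(1) by auto
qed

text \<open>Expresses that the homogeneous vanishing ideal is prime. Later \<open>C\<close> consists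
  of one chosen coordinate vector for each point of an irreducible closed set, which determines the
  vanishing of forms just as the full cone does.\<close>

definition prime_cone :: "('i::finite \<Rightarrow> 'a::field) set \<Rightarrow> bool" where
  "prime_cone C \<longleftrightarrow> C \<noteq> {} \<and> (\<forall>m n u v. hform m u \<longrightarrow> hform n v \<longrightarrow> (\<forall>x\<in>C. u x * v x = 0) \<longrightarrow>
     (\<forall>x\<in>C. u x = 0) \<or> (\<forall>x\<in>C. v x = 0))"

lemma sum_lessThan_add:
  fixes f :: "nat \<Rightarrow> 'a::comm_monoid_add"
  shows "(\<Sum>a<m + n. f a) = (\<Sum>a<m. f a) + (\<Sum>a<n. f (m + a))"
  by (induction n) (auto simp: add.assoc)

text \<open>If \<open>f\<close> vanishes on \<open>C'\<close> but not on \<open>C\<close>, multiplication by \<open>f\<close> embeds the coordinate ring of \<open>C\<close>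
  into the kernel of its restriction to \<open>C'\<close>.\<close>

lemma independent_forms_step:
  assumes C: "prime_cone C" and "C' \<subseteq> C"
    and f: "hform e f" "\<And>x. x \<in> C' \<Longrightarrow> f x = 0" "\<exists>x\<in>C. f x \<noteq> 0"
    and 1: "independent_forms C' (e + n) m'" and 2: "independent_forms C n m"
  shows "independent_forms C (e + n) (m' + m)"
proof -
  obtain v where v: "\<And>a. a < m' \<Longrightarrow> hform (e + n) (v a)"
    "\<And>c. \<forall>x\<in>C'. (\<Sum>a<m'. c a * v a x) = 0 \<Longrightarrow> \<forall>a<m'. c a = 0"
    using 1 by (auto simp: independent_forms_def)
  obtain w where w: "\<And>a. a < m \<Longrightarrow> hform n (w a)"
    "\<And>c. \<forall>x\<in>C. (\<Sum>a<m. c a * w a x) = 0 \<Longrightarrow> \<forall>a<m. c a = 0"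
    using 2 by (auto simp: independent_forms_def)
  define z where "z = (\<lambda>a x. if a < m' then v a x else f x * w (a - m') x)"
  have z: "hform (e + n) (z a)" if "a < m' + m" for a
  proof (cases "a < m'")
    case True
    then have "z a = v a" by (auto simp: z_def)
    then show ?thesis using v(1) True by simp
  next
    case False
    then have "z a = (\<lambda>x. f x * w (a - m') x)" by (auto simp: z_def)
    then show ?thesis using hform_mult[OF f(1) w(1)] that False by simp
  qed
  have "\<forall>a<m' + m. c a = 0" if c: "\<forall>x\<in>C. (\<Sum>a<m' + m. c a * z a x) = 0" for c
  proof -
    have split: "(\<Sum>a<m' + m. c a * z a x) =
        (\<Sum>a<m'. c a * v a x) + f x * (\<Sum>a<m. c (m' + a) * w a x)" for x
      unfolding sum_lessThan_add by (simp add: z_def sum_distrib_left mult.left_commute)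
    \<comment> \<open>On \<open>C'\<close> the second sum drops out because \<open>f\<close>
      vanishes there. With these coefficients gone, primality of \<open>C\<close> cancels
      \<open>f\<close> from the second sum.\<close>
    have c1: "\<forall>a<m'. c a = 0"
    proof (rule v(2), rule ballI)
      fix x assume "x \<in> C'"
      then show "(\<Sum>a<m'. c a * v a x) = 0"
        using c \<open>C' \<subseteq> C\<close> f(2)[of x] split[of x] by auto
    qed
    have "hform n (\<lambda>x. \<Sum>a<m. c (m' + a) * w a x)"
      using w(1) by (intro hform_sum hform_scale) auto
    moreover have "\<forall>x\<in>C. f x * (\<Sum>a<m. c (m' + a) * w a x) = 0"
      using c split c1 by simp
    ultimately have "\<forall>x\<in>C. (\<Sum>a<m. c (m' + a) * w a x) = 0"
      using C f(1,3) unfolding prime_cone_def by blast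
    from w(2)[OF this] have c2: "\<forall>a<m. c (m' + a) = 0" .
    show ?thesis
    proof (intro allI impI)
      fix a assume "a < m' + m"
      then show "c a = 0" using c1 c2[rule_format, of "a - m'"] by (cases "a < m'") auto
    qed
  qed
  then show ?thesis using z unfolding independent_forms_def by (intro exI[of _ z]) auto
qed

text \<open>Induction along the chain and, for each member, on \<open>k\<close>:
  \<open>independent_forms_step\<close> adds the bounds for \<open>C g\<close> and
  \<open>C (Suc g)\<close>, and Pascal's rule adds the binomial coefficients. Only multiples of a
  suitable \<open>d\<close> are considered, because the separating forms have arbitrary
  degrees.\<close>

lemma independent_forms_chain:
  fixes C :: "nat \<Rightarrow> ('i::finite \<Rightarrow> 'a::field) set"
  assumes "\<And>j. j \<le> g \<Longrightarrow> prime_cone (C j)" and "\<And>j. j < g \<Longrightarrow> C j \<subseteq> C (Suc j)"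
    and "\<And>j. j < g \<Longrightarrow> \<exists>e f. hform e f \<and> (\<forall>x\<in>C j. f x = 0) \<and> (\<exists>x\<in>C (Suc j). f x \<noteq> 0)"
    and "(\<lambda>_. 0) \<notin> C 0"
  shows "\<exists>d>0. \<forall>k. independent_forms (C g) (k * d) ((k + g) choose g)"
  using assms(1-3)
proof (induction g)
  case 0
  then obtain x where x: "x \<in> C 0" by (auto simp: prime_cone_def)
  then obtain i where i: "x i \<noteq> 0" using assms(4) by (metis ext)
  have "independent_forms (C 0) k 1" for k
    unfolding independent_forms_def
    using hform_power[OF hform_var[of i], of k] x i
    by (intro exI[of _ "\<lambda>_ x. x i ^ k"]) auto
  then show ?case by (intro exI[of _ 1]) simp
next
  case (Suc g)
  then obtain d where d: "d > 0" "\<And>k. independent_forms (C g) (k * d) ((k + g) choose g)"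
    by (auto simp: less_Suc_eq le_Suc_eq)
  obtain e f x where f: "hform e f" "\<And>y. y \<in> C g \<Longrightarrow> f y = 0" "x \<in> C (Suc g)" "f x \<noteq> 0"
    using Suc.prems(3)[of g] by auto
  obtain y where "y \<in> C g" using Suc.prems(1)[of g] by (auto simp: prime_cone_def)
  have "e \<noteq> 0"
  proof
    assume "e = 0"
    then show False using f \<open>y \<in> C g\<close> hform_0_const[of f x y] by simp
  qed
  have CS: "prime_cone (C (Suc g))" "C g \<subseteq> C (Suc g)" using Suc.prems by auto
  \<comment> \<open>The degree of \<open>f ^ d\<close>. It is a multiple of \<open>d\<close>, so the
    bound for \<open>C g\<close> applies in all degrees \<open>k * D\<close>.\<close>
  define D where "D = e * d"
  have "independent_forms (C (Suc g)) (k * D) ((k + Suc g) choose Suc g)" for k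
  proof (induction k)
    case 0
    have "independent_forms (C (Suc g)) 0 1"
      unfolding independent_forms_def using f(3)
      by (intro exI[of _ "\<lambda>_ _. 1"]) (auto intro: hform_const)
    then show ?case by simp
  next
    case (Suc k)
    \<comment> \<open>Degree \<open>Suc k * D\<close> is \<open>(Suc k * e) * d\<close>, so the
      bound for \<open>C g\<close> holds there with \<open>Suc k * e\<close> in place of
      \<open>Suc k\<close>, which is only better.\<close>
    have "Suc k * 1 \<le> Suc k * e" using \<open>e \<noteq> 0\<close> by (intro mult_le_mono2) simp
    then have "Suc k \<le> Suc k * e" by (simp only: mult_1_right)
    then have "(Suc k + g) choose g \<le> (Suc k * e + g) choose g"
      by (intro binomial_right_mono) simp
    then have "independent_forms (C g) (D + k * D) ((Suc k + g) choose g)"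
      using independent_forms_le[OF d(2)[of "Suc k * e"]] by (simp add: D_def algebra_simps)
    moreover have "hform D (\<lambda>x. f x ^ d)" unfolding D_def by (rule hform_power[OF f(1)])
    ultimately have "independent_forms (C (Suc g)) (D + k * D)
        (((Suc k + g) choose g) + ((k + Suc g) choose Suc g))"
      using Suc.IH CS f d(1)
      by (intro independent_forms_step[of "C (Suc g)" "C g" D "\<lambda>x. f x ^ d"]) auto
    then show ?case by simp
  qed
  then show ?case using d(1) \<open>e \<noteq> 0\<close> by (intro exI[of _ D]) (simp add: D_def)
qed

lemma binomial_not_le_lower_degree:
  assumes "s < g" "d > 0"
  shows "\<exists>k. C * (k * d + 1) ^ s < (k + g) choose g"
proof -
  \<comment> \<open>Take \<open>k = g * K\<close>. Then the left side is at most
    \<open>K * (K + 1) ^ s\<close>, which is less than \<open>(K + 1) ^ g\<close>, and the estimate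
    of a binomial coefficient by the \<open>g\<close>-th power of \<open>(k + g) / g = K + 1\<close>
    finishes.\<close>
  define K where "K = C * (g * d) ^ s"
  have "K * (K + 1) ^ s < (K + 1) ^ Suc s" by simp
  also have "\<dots> \<le> (K + 1) ^ g" using assms by (intro power_increasing) auto
  also have "\<dots> \<le> (g * K + g) choose g"
  proof -
    have "(real (g * K + g) / real g) ^ g \<le> real ((g * K + g) choose g)"
      using binomial_ge_n_over_k_pow_k[of g "g * K + g", where ?'a = real] by simp
    also have "real (g * K + g) / real g = real (K + 1)"
      using assms by (simp add: field_simps)
    finally show ?thesis by (metis of_nat_le_iff of_nat_power)
  qed
  finally have "K * (K + 1) ^ s < (g * K + g) choose g" .
  moreover have "C * (g * K * d + 1) ^ s \<le> K * (K + 1) ^ s"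
  proof -
    have "g * K * d + 1 \<le> g * d * (K + 1)" using assms by (simp add: algebra_simps)
    then have "(g * K * d + 1) ^ s \<le> (g * d) ^ s * (K + 1) ^ s"
      by (metis power_mono power_mult_distrib zero_le)
    then show ?thesis unfolding K_def by (metis mult.assoc mult_le_mono2)
  qed
  ultimately show ?thesis by (intro exI[of _ "g * K"]) simp
qed

text \<open>If the ideal generated by the vanishing ideal and \<open>gs\<close> were not relevant,
  the Hilbert function of \<open>C g\<close> would be bounded by a polynomial of degree less than
  \<open>g\<close>, contrary to \<open>independent_forms_chain\<close>. So the Nullstellensatz
  provides a common zero.\<close>

theorem projective_dimension:
  fixes C :: "nat \<Rightarrow> ('i::finite \<Rightarrow> 'a::alg_closed_field) set"
  assumes chain: "\<And>j. j \<le> g \<Longrightarrow> prime_cone (C j)" "\<And>j. j < g \<Longrightarrow> C j \<subseteq> C (Suc j)"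
      "\<And>j. j < g \<Longrightarrow> \<exists>e f. hform e f \<and> (\<forall>x\<in>C j. f x = 0) \<and> (\<exists>x\<in>C (Suc j). f x \<noteq> 0)"
      "(\<lambda>_. 0) \<notin> C 0"
    and gs: "\<And>a f. (a, f) \<in> set gs \<Longrightarrow> hform a f \<and> a > 0" and "length gs \<le> g"
  obtains x where "x \<noteq> (\<lambda>_. 0)" "\<And>n f. (n, f) \<in> vanishing_ideal (C g) \<Longrightarrow> f x = 0"
    "\<And>a f. (a, f) \<in> set gs \<Longrightarrow> f x = 0"
proof -
  let ?I = "vanishing_ideal (C g)"
  obtain d where d: "d > 0" "\<And>k. independent_forms (C g) (k * d) ((k + g) choose g)"
    using independent_forms_chain[OF chain] by blast
  have ideal: "graded_ideal (adjoin_all gs ?I)"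
    using gs by (intro graded_ideal_adjoin_all graded_ideal_vanishing_ideal) blast
  have "relevant (adjoin_all gs ?I)"
  proof (rule ccontr)
    assume "\<not> relevant (adjoin_all gs ?I)"
    then obtain N where "\<And>f. hform N f \<Longrightarrow> (N, f) \<in> adjoin_all gs ?I"
      by (auto simp: relevant_def)
    then have "span_dim (adjoin_all gs ?I) n 0" if "N \<le> n" for n
      unfolding span_dim_def using ideal_upward[OF ideal _ that]
      by (intro exI[of _ "{}"]) auto
    then have "growth_at_most (adjoin_all gs ?I) 0" by (auto simp: growth_at_most_def)
    then have gr: "growth_at_most ?I (length gs)"
      using growth_at_most_adjoin_all[OF graded_ideal_vanishing_ideal gs, of gs "C g" 0] by simp
    show False
    proof (cases "length gs")
      case 0
      with gr obtain M where "\<And>n. n \<ge> M \<Longrightarrow> span_dim ?I n 0"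
        by (auto simp: growth_at_most_def)
      \<comment> \<open>For empty \<open>gs\<close> the Hilbert function would vanish from degree
        \<open>M\<close> on; the degree \<open>M * d\<close> is one where a positive lower bound is
        known.\<close>
      moreover have "M \<le> M * d" using d(1) by simp
      ultimately have "(M + g) choose g \<le> 0"
        using independent_forms_le_span_dim[OF d(2)[of M]] by blast
      then show False by simp
    next
      case (Suc s)
      with gr obtain K where "\<And>n. span_dim ?I n (K * (n + 1) ^ s)"
        by (auto simp: growth_at_most_def)
      then have le: "(k + g) choose g \<le> K * (k * d + 1) ^ s" for k
        using independent_forms_le_span_dim[OF d(2)[of k]] by blast
      have "s < g" using Suc \<open>length gs \<le> g\<close> by simp
      then obtain k where "K * (k * d + 1) ^ s < (k + g) choose g"
        using binomial_not_le_lower_degree d(1) by blast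
      then show False using le[of k] by simp
    qed
  qed
  from projective_nullstellensatz[OF ideal this] obtain x where
    x: "x \<noteq> (\<lambda>_. 0)" "\<And>n f. (n, f) \<in> adjoin_all gs ?I \<Longrightarrow> f x = 0" by blast
  moreover have "?I \<subseteq> adjoin_all gs ?I" by (rule subset_adjoin_all)
  moreover have "set gs \<subseteq> adjoin_all gs ?I"
    using gs by (intro generators_in_adjoin_all graded_ideal_vanishing_ideal) blast
  ultimately show ?thesis using that by blast
qed

section \<open>Forms and closed sets in projective space\<close>

lemma mono_eval_superset:
  assumes "finite S" "Poly_Mapping.keys t \<subseteq> S"
  shows "(\<Prod>v\<in>Poly_Mapping.keys t. x v ^ Poly_Mapping.lookup t v) =
    (\<Prod>v\<in>S. (x v :: 'b::comm_monoid_mult) ^ Poly_Mapping.lookup t v)"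
  using assms by (intro prod.mono_neutral_left) (auto simp: in_keys_iff)

lemma mono_eval_add:
  "(\<Prod>v\<in>Poly_Mapping.keys (s + t). (x v :: 'b::comm_monoid_mult) ^ Poly_Mapping.lookup (s + t) v) =
    (\<Prod>v\<in>Poly_Mapping.keys s. x v ^ Poly_Mapping.lookup s v) *
    (\<Prod>v\<in>Poly_Mapping.keys t. x v ^ Poly_Mapping.lookup t v)"
  using mono_eval_superset[of "Poly_Mapping.keys s \<union> Poly_Mapping.keys t" "s + t" x]
    mono_eval_superset[of "Poly_Mapping.keys s \<union> Poly_Mapping.keys t" s x]
    mono_eval_superset[of "Poly_Mapping.keys s \<union> Poly_Mapping.keys t" t x]
    Poly_Mapping.keys_add[of s t]
  by (simp add: lookup_add power_add prod.distrib)

lemma mono_eval_single: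
  "(\<Prod>v\<in>Poly_Mapping.keys (Poly_Mapping.single w n).
      (x v :: 'b::comm_monoid_mult) ^ Poly_Mapping.lookup (Poly_Mapping.single w n) v) = x w ^ n"
  by (cases "n = 0") auto

lemma mono_eval_sum:
  assumes "finite A"
  shows "(\<Prod>v\<in>Poly_Mapping.keys (\<Sum>a\<in>A. t a).
      (x v :: 'b::comm_monoid_mult) ^ Poly_Mapping.lookup (\<Sum>a\<in>A. t a) v) =
    (\<Prod>a\<in>A. \<Prod>v\<in>Poly_Mapping.keys (t a). x v ^ Poly_Mapping.lookup (t a) v)"
  using assms by (induction A rule: finite_induct) (auto simp: mono_eval_add)

lemma sum_monomials: "p = (\<Sum>t\<in>Poly_Mapping.keys p. Poly_Mapping.single t (Poly_Mapping.lookup p t))"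
  by (rule poly_mapping_eqI)
    (auto simp: lookup_sum lookup_single when_def in_keys_iff sum.delta)

definition ring_morphism :: "('a::comm_ring_1 \<Rightarrow> 'b::comm_ring_1) \<Rightarrow> bool" where
  "ring_morphism h \<longleftrightarrow>
     h 0 = 0 \<and> h 1 = 1 \<and> (\<forall>a b. h (a + b) = h a + h b) \<and> (\<forall>a b. h (a * b) = h a * h b)"

lemma ring_morphism_id: "ring_morphism id"
  and ring_morphism_to_ac: "ring_morphism to_ac"
  by (auto simp: ring_morphism_def)

context
  fixes h :: "'a::comm_ring_1 \<Rightarrow> 'b::comm_ring_1"
  assumes h: "ring_morphism h"
begin

text \<open>Cancellation can shrink the support of a sum; summing over a common larger set makes
  evaluation visibly additive.\<close>

lemma evalp_superset:
  assumes "finite S" "Poly_Mapping.keys p \<subseteq> S"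
  shows "evalp h p x = (\<Sum>t\<in>S. h (Poly_Mapping.lookup p t) *
    (\<Prod>v\<in>Poly_Mapping.keys t. x v ^ Poly_Mapping.lookup t v))"
  unfolding evalp_def using assms h
  by (intro sum.mono_neutral_left) (auto simp: in_keys_iff ring_morphism_def)

lemma evalp_zero: "evalp h 0 x = 0"
  by (simp add: evalp_def)

lemma evalp_add: "evalp h (p + q) x = evalp h p x + evalp h q x"
proof -
  let ?S = "Poly_Mapping.keys p \<union> Poly_Mapping.keys q"
  have "Poly_Mapping.keys (p + q) \<subseteq> ?S" by (rule Poly_Mapping.keys_add)
  then show ?thesis
    using h by (simp add: evalp_superset[of ?S] lookup_add ring_morphism_def distrib_right sum.distrib)
qed

lemma evalp_sum: "evalp h (\<Sum>a\<in>A. p a) x = (\<Sum>a\<in>A. evalp h (p a) x)"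
  by (induction A rule: infinite_finite_induct) (auto simp: evalp_zero evalp_add)

lemma evalp_single:
  "evalp h (Poly_Mapping.single t c) x =
    h c * (\<Prod>v\<in>Poly_Mapping.keys t. x v ^ Poly_Mapping.lookup t v)"
  using h by (subst evalp_superset[of "{t}"]) (auto simp: ring_morphism_def)

lemma evalp_mult: "evalp h (p * q) x = evalp h p x * evalp h q x"
proof -
  have "evalp h (Poly_Mapping.single s a * Poly_Mapping.single t b) x =
      evalp h (Poly_Mapping.single s a) x * evalp h (Poly_Mapping.single t b) x" for s a t b
    using h by (simp add: mult_single evalp_single mono_eval_add ring_morphism_def algebra_simps)
  then have "evalp h (\<Sum>s\<in>Poly_Mapping.keys p. \<Sum>t\<in>Poly_Mapping.keys q.
        Poly_Mapping.single s (Poly_Mapping.lookup p s) * Poly_Mapping.single t (Poly_Mapping.lookup q t)) x =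
      evalp h (\<Sum>s\<in>Poly_Mapping.keys p. Poly_Mapping.single s (Poly_Mapping.lookup p s)) x *
      evalp h (\<Sum>t\<in>Poly_Mapping.keys q. Poly_Mapping.single t (Poly_Mapping.lookup q t)) x"
    by (simp only: sum_product evalp_sum)
  then show ?thesis
    by (simp only: sum_product[symmetric] sum_monomials[symmetric])
qed

lemma evalp_uminus: "evalp h (- p) x = - evalp h p x"
  using evalp_add[of p "- p" x] by (simp add: evalp_zero eq_neg_iff_add_eq_0 add.commute)

lemma evalp_rename_vars: "evalp h (rename_vars f p) x = evalp h p (x \<circ> f)"
  unfolding rename_vars_def evalp_sum evalp_single evalp_def[of h p]
  by (simp add: mono_eval_sum mono_eval_single del: keys_single)

end

section \<open>Polynomial forms and the functions they define\<close>

lemma is_form_add: "is_form n p \<Longrightarrow> is_form n q \<Longrightarrow> is_form n (p + q)"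
  using Poly_Mapping.keys_add[of p q] by (auto simp: is_form_def)

lemma is_form_mult:
  fixes p q :: "('i::finite, 'a::comm_ring_1) mpol"
  assumes "is_form m p" "is_form n q"
  shows "is_form (m + n) (p * q)"
  unfolding is_form_def
proof
  fix t assume "t \<in> Poly_Mapping.keys (p * q)"
  then obtain a b where "t = a + b" "a \<in> Poly_Mapping.keys p" "b \<in> Poly_Mapping.keys q"
    using Poly_Mapping.keys_mult[of p q] by auto
  then show "(\<Sum>i\<in>UNIV. Poly_Mapping.lookup t i) = m + n"
    using assms by (simp add: is_form_def lookup_add sum.distrib)
qed

lemma is_biform_imp_is_form: "is_biform m n q \<Longrightarrow> is_form (m + n) q"
  unfolding is_biform_def is_form_def
  by (subst UNIV_Plus_UNIV[symmetric], subst sum.Plus) auto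

lemma hform_evalp:
  assumes "is_form n p"
  shows "hform n (evalp h p)"
proof -
  have "hform n (\<lambda>x. \<Prod>v\<in>Poly_Mapping.keys t. x v ^ Poly_Mapping.lookup t v)"
    if t: "t \<in> Poly_Mapping.keys p" for t
  proof -
    have "hform (\<Sum>v\<in>UNIV. 1 * Poly_Mapping.lookup t v) (\<lambda>x. \<Prod>v\<in>UNIV. x v ^ Poly_Mapping.lookup t v)"
      by (intro hform_prod hform_power hform_var)
    moreover have "(\<Sum>v\<in>UNIV. 1 * Poly_Mapping.lookup t v) = n"
      using assms t by (auto simp: is_form_def)
    ultimately show ?thesis by (simp add: mono_eval_superset[of UNIV])
  qed
  then show ?thesis unfolding evalp_def[abs_def] by (intro hform_sum hform_scale)
qed

text \<open>Constants (degree 0) substituted for one group of variables freeze that argument at a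
  point; linear forms substituted for the second group restrict to the antidiagonal.\<close>

lemma hform_evalp_substitute:
  assumes "is_biform m n q" "\<And>i. hform d (M i)" "\<And>i. hform e (L i)"
  shows "hform (d * m + e * n) (\<lambda>x. evalp h q (case_sum (\<lambda>i. M i x) (\<lambda>i. L i x)))"
proof -
  have "hform (d * m + e * n)
      (\<lambda>x. \<Prod>v\<in>Poly_Mapping.keys t. case_sum (\<lambda>i. M i x) (\<lambda>i. L i x) v ^ Poly_Mapping.lookup t v)"
    if t: "t \<in> Poly_Mapping.keys q" for t
  proof -
    have "hform ((\<Sum>i\<in>UNIV. d * Poly_Mapping.lookup t (Inl i)) + (\<Sum>i\<in>UNIV. e * Poly_Mapping.lookup t (Inr i)))
      (\<lambda>x. (\<Prod>i\<in>UNIV. M i x ^ Poly_Mapping.lookup t (Inl i)) *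
        (\<Prod>i\<in>UNIV. L i x ^ Poly_Mapping.lookup t (Inr i)))"
      by (intro hform_mult hform_prod hform_power assms)
    moreover have "(\<Sum>i\<in>UNIV. d * Poly_Mapping.lookup t (Inl i)) = d * m"
      "(\<Sum>i\<in>UNIV. e * Poly_Mapping.lookup t (Inr i)) = e * n"
      using assms(1) t by (auto simp: is_biform_def simp flip: sum_distrib_left)
    moreover have "(\<Prod>v\<in>Poly_Mapping.keys t. case_sum (\<lambda>i. M i x) (\<lambda>i. L i x) v ^ Poly_Mapping.lookup t v) =
      (\<Prod>i\<in>UNIV. M i x ^ Poly_Mapping.lookup t (Inl i)) *
      (\<Prod>i\<in>UNIV. L i x ^ Poly_Mapping.lookup t (Inr i))" for x
      by (subst mono_eval_superset[of UNIV], simp, simp, subst UNIV_Plus_UNIV[symmetric], subst prod.Plus) auto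
    ultimately show ?thesis by simp
  qed
  then show ?thesis unfolding evalp_def by (intro hform_sum hform_scale)
qed

text \<open>The converse of \<open>hform_evalp\<close>. It makes zero sets of form functions Zariski
  closed.\<close>

lemma ex_form_of_hform:
  fixes f :: "('i::finite \<Rightarrow> 'a::field) \<Rightarrow> 'a"
  shows "hform n f \<Longrightarrow> \<exists>p. is_form n p \<and> evalp id p = f"
proof (induction rule: hform.induct)
  case (hform_const c)
  have "evalp id (Poly_Mapping.single 0 c) = (\<lambda>_ :: 'i \<Rightarrow> 'a. c)"
    using evalp_single[OF ring_morphism_id, of 0 c] by (intro ext) simp
  moreover have "is_form 0 (Poly_Mapping.single 0 c :: ('i, 'a) mpol)"
    by (auto simp: is_form_def)
  ultimately show ?case by blast
next
  case (hform_zero n)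
  show ?case by (intro exI[of _ 0]) (auto simp: is_form_def evalp_def)
next
  case (hform_add n f g)
  then obtain p q where "is_form n p" "evalp id p = f" "is_form n q" "evalp id q = g" by blast
  moreover from this have "evalp id (p + q) = (\<lambda>x. f x + g x)"
    by (intro ext) (simp only: evalp_add[OF ring_morphism_id])
  ultimately show ?case using is_form_add by blast
next
  case (hform_times_var n f i)
  then obtain p where p: "is_form n p" "evalp id p = f" by blast
  define s :: "('i, 'a) mpol" where "s = Poly_Mapping.single (Poly_Mapping.single i 1) 1"
  have "is_form 1 s"
    by (auto simp: s_def is_form_def lookup_single when_def)
  then have "is_form (Suc n) (s * p)" using is_form_mult[of 1 s n p] p(1) by simp
  moreover have "evalp id s x = x i" for x
    by (simp add: s_def evalp_single[OF ring_morphism_id] mono_eval_single)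
  then have "evalp id (s * p) = (\<lambda>x. x i * f x)"
    by (intro ext) (simp only: evalp_mult[OF ring_morphism_id] p(2))
  ultimately show ?case by blast
qed

section \<open>Homogeneous coordinates and closed sets\<close>

lemma hcoords_nonzero: "hcoords P \<noteq> (\<lambda>_. 0)"
  using Quotient3_rep_reflp[OF Quotient3_proj_space, of P] by (auto simp: proj_rel_def)

lemma has_hcoords_iff: "has_hcoords P x \<longleftrightarrow> (\<exists>c. c \<noteq> 0 \<and> x = (\<lambda>i. c * hcoords P i))"
proof
  assume "has_hcoords P x"
  then have x: "x \<noteq> (\<lambda>_. 0)" "abs_proj_space x = P" by (auto simp: has_hcoords_def)
  have "proj_rel x x" using x(1) unfolding proj_rel_def by (intro conjI exI[of _ 1]) auto
  then have "proj_rel (hcoords P) x"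
    using x(2) Quotient3_rep_abs[OF Quotient3_proj_space] by blast
  then show "\<exists>c. c \<noteq> 0 \<and> x = (\<lambda>i. c * hcoords P i)" by (auto simp: proj_rel_def)
next
  assume "\<exists>c. c \<noteq> 0 \<and> x = (\<lambda>i. c * hcoords P i)"
  then have "proj_rel (hcoords P) x" using hcoords_nonzero by (auto simp: proj_rel_def)
  then have "abs_proj_space x = P" "proj_rel x x"
    using Quotient3_rel[OF Quotient3_proj_space, of "hcoords P" x]
      Quotient3_abs_rep[OF Quotient3_proj_space, of P] by auto
  then show "has_hcoords P x" by (auto simp: has_hcoords_def proj_rel_def)
qed

lemma has_hcoords_unique: "has_hcoords P x \<Longrightarrow> has_hcoords Q x \<Longrightarrow> P = Q"
  by (auto simp: has_hcoords_def)

lemma zariski_closed_hforms: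
  fixes T :: "(nat \<times> (('i::finite \<Rightarrow> 'a::field) \<Rightarrow> 'a)) set"
  assumes "\<And>n f. (n, f) \<in> T \<Longrightarrow> hform n f"
  shows "zariski_closed id {P. \<forall>(n, f)\<in>T. f (hcoords P) = 0}"
proof -
  define T' where "T' = {p :: ('i, 'a) mpol. \<exists>n f. (n, f) \<in> T \<and> is_form n p \<and> evalp id p = f}"
  have "(\<forall>(n, f)\<in>T. f x = 0) \<longleftrightarrow> (\<forall>p\<in>T'. evalp id p x = 0)" for x
    using ex_form_of_hform[OF assms] unfolding T'_def by fastforce
  then show ?thesis
    unfolding zariski_closed_def by (intro exI[of _ T']) (auto simp: T'_def)
qed

lemma zariski_closed_hform: "hform n f \<Longrightarrow> zariski_closed id {P. f (hcoords P) = 0}"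
  using zariski_closed_hforms[of "{(n, f)}"] by simp

lemma zariski_closed_point: "zariski_closed id {P :: ('i::finite, 'a::field) proj_space}"
proof -
  \<comment> \<open>The 2 by 2 minors of the matrix with rows \<open>hcoords P\<close> and
    \<open>x\<close>; they vanish exactly when \<open>x\<close> is proportional to
    \<open>hcoords P\<close>.\<close>
  define T where "T = {(1 :: nat, \<lambda>x. hcoords P j * x i - hcoords P i * x j) | i j. True}"
  obtain j where j: "hcoords P j \<noteq> 0" using hcoords_nonzero by (metis ext)
  have "Q = P" if Q: "\<forall>(n, f)\<in>T. f (hcoords Q) = 0" for Q
  proof -
    have *: "hcoords P j * hcoords Q i = hcoords P i * hcoords Q j" for i
    proof -
      have "(1, \<lambda>x. hcoords P j * x i - hcoords P i * x j) \<in> T" by (auto simp: T_def)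
      with Q show ?thesis by fastforce
    qed
    have "hcoords Q j \<noteq> 0"
    proof
      assume "hcoords Q j = 0"
      then have "hcoords Q i = 0" for i using *[of i] j by simp
      then show False using hcoords_nonzero by (metis ext)
    qed
    moreover have "hcoords Q = (\<lambda>i. hcoords Q j / hcoords P j * hcoords P i)"
      using * j by (simp add: fun_eq_iff field_simps)
    ultimately have "has_hcoords P (hcoords Q)"
      using j unfolding has_hcoords_iff by (intro exI[of _ "hcoords Q j / hcoords P j"]) auto
    moreover have "has_hcoords Q (hcoords Q)"
      unfolding has_hcoords_iff by (intro exI[of _ 1]) auto
    ultimately show ?thesis using has_hcoords_unique by blast
  qed
  moreover have "\<forall>(n, f)\<in>T. f (hcoords P) = 0" by (auto simp: T_def)
  ultimately have "{P} = {Q. \<forall>(n, f)\<in>T. f (hcoords Q) = 0}" by blast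
  moreover have "hform n f" if "(n, f) \<in> T" for n f
    using that by (auto simp: T_def intro!: hform_diff hform_scale hform_var[simplified])
  ultimately show ?thesis using zariski_closed_hforms[of T] by simp
qed

lemma zariski_closed_point_in:
  assumes "zariski_closed id Z" "P \<notin> Z"
  obtains n f where "hform n f" "\<And>Q. Q \<in> Z \<Longrightarrow> f (hcoords Q) = 0" "f (hcoords P) \<noteq> 0"
proof -
  obtain T where T: "\<forall>F\<in>T. \<exists>n. is_form n F" "Z = {P. \<forall>F\<in>T. evalp id F (hcoords P) = 0}"
    using assms(1) by (auto simp: zariski_closed_def)
  with assms(2) obtain F n where "F \<in> T" "is_form n F" "evalp id F (hcoords P) \<noteq> 0" by auto
  then show ?thesis using that[OF hform_evalp] T(2) by auto
qed

lemma prime_cone_irreducible_closed: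
  assumes "irreducible_closed Z"
  shows "prime_cone (hcoords ` Z)"
  unfolding prime_cone_def
proof (intro conjI allI impI)
  show "hcoords ` Z \<noteq> {}" using assms by (auto simp: irreducible_closed_def)
next
  fix m n u v
  assume uv: "hform m u" "hform n v" "\<forall>x\<in>hcoords ` Z. u x * v x = 0"
  then have "Z \<subseteq> {P. u (hcoords P) = 0} \<union> {P. v (hcoords P) = 0}" by auto
  with assms have "Z \<subseteq> {P. u (hcoords P) = 0} \<or> Z \<subseteq> {P. v (hcoords P) = 0}"
    using zariski_closed_hform[OF uv(1)] zariski_closed_hform[OF uv(2)]
    unfolding irreducible_closed_def by blast
  then show "(\<forall>x\<in>hcoords ` Z. u x = 0) \<or> (\<forall>x\<in>hcoords ` Z. v x = 0)" by auto
qed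

section \<open>Krull dimension and common zeros\<close>

lemma Sup_enat_attained:
  assumes "Sup D = enat g" "g > 0"
  shows "enat g \<in> D"
proof -
  \<comment> \<open>The empty set has supremum 0, which \<open>g > 0\<close> excludes. Finiteness of
    the supremum then makes \<open>D\<close> finite, so it is a maximum.\<close>
  have "D \<noteq> {}" using assms by (auto simp: Sup_enat_def zero_enat_def)
  moreover have "finite D" using assms(1) \<open>D \<noteq> {}\<close> by (auto simp: Sup_enat_def split: if_splits)
  ultimately show ?thesis using assms(1) Max_in[of D] by (simp add: Sup_enat_def)
qed

lemma krull_dim_eq_enat:
  assumes "krull_dim V = enat g" "g > 0"
  obtains Z where "\<And>i. i \<le> g \<Longrightarrow> irreducible_closed (Z i) \<and> Z i \<subseteq> V"
    "\<And>i. i < g \<Longrightarrow> Z i \<subset> Z (Suc i)"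
proof -
  let ?D = "{enat n | n. \<exists>Z :: nat \<Rightarrow> _.
     (\<forall>i\<le>n. irreducible_closed (Z i) \<and> Z i \<subseteq> V) \<and> (\<forall>i<n. Z i \<subset> Z (Suc i))}"
  have "enat g \<in> ?D"
    using assms unfolding krull_dim_def by (rule Sup_enat_attained)
  then show ?thesis using that by auto
qed

text \<open>Applies \<open>projective_dimension\<close> to a chain that attains the dimension. The
  zero found lies in the top member \<open>Z g\<close>, because some form vanishing on the closed
  set \<open>Z g\<close> would be nonzero at any point outside it.\<close>

theorem ex_common_zero_on_variety:
  fixes V :: "('i::finite, 'a::alg_closed_field) proj_space set"
  assumes "irreducible_closed V" "krull_dim V = enat g" "g > 0"
    and gs: "\<And>a f. (a, f) \<in> set gs \<Longrightarrow> hform a f \<and> a > 0" and "length gs \<le> g"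
  obtains P where "P \<in> V" "\<And>a f. (a, f) \<in> set gs \<Longrightarrow> f (hcoords P) = 0"
proof -
  obtain Z where Z: "\<And>i. i \<le> g \<Longrightarrow> irreducible_closed (Z i) \<and> Z i \<subseteq> V"
    "\<And>i. i < g \<Longrightarrow> Z i \<subset> Z (Suc i)"
    using krull_dim_eq_enat[OF assms(2,3)] by blast
  have "\<exists>e f. hform e f \<and> (\<forall>x\<in>hcoords ` Z j. f x = 0) \<and> (\<exists>x\<in>hcoords ` Z (Suc j). f x \<noteq> 0)"
    if j: "j < g" for j
  proof -
    obtain P where P: "P \<in> Z (Suc j)" "P \<notin> Z j" using Z(2)[OF j] by auto
    have "zariski_closed id (Z j)" using Z(1)[of j] j by (auto simp: irreducible_closed_def)
    then obtain e f where "hform e f" "\<And>Q. Q \<in> Z j \<Longrightarrow> f (hcoords Q) = 0" "f (hcoords P) \<noteq> 0"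
      using zariski_closed_point_in[OF _ P(2)] by blast
    then show ?thesis using P(1) by (intro exI[of _ e] exI[of _ f]) auto
  qed
  moreover have "prime_cone (hcoords ` Z j)" if "j \<le> g" for j
    using Z(1)[OF that] prime_cone_irreducible_closed by blast
  moreover have "hcoords ` Z j \<subseteq> hcoords ` Z (Suc j)" if "j < g" for j
    using Z(2)[OF that] by blast
  moreover have "(\<lambda>_. 0) \<notin> hcoords ` Z 0" using hcoords_nonzero by (metis imageE)
  ultimately obtain x where x: "x \<noteq> (\<lambda>_. 0)"
    "\<And>n f. (n, f) \<in> vanishing_ideal (hcoords ` Z g) \<Longrightarrow> f x = 0"
    "\<And>a f. (a, f) \<in> set gs \<Longrightarrow> f x = 0"
    using projective_dimension[of g "\<lambda>j. hcoords ` Z j" gs] gs \<open>length gs \<le> g\<close> by blast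
  define P where "P = abs_proj_space x"
  have "has_hcoords P x" using x(1) by (simp add: has_hcoords_def P_def)
  then obtain c where c: "c \<noteq> 0" "x = (\<lambda>i. c * hcoords P i)" by (auto simp: has_hcoords_iff)
  have at_P: "f (hcoords P) = 0" if "hform n f" "f x = 0" for n f
    using hform_homogeneous[OF that(1), of c "hcoords P"] c that(2) by simp
  have "P \<in> Z g"
  proof (rule ccontr)
    assume "P \<notin> Z g"
    moreover have "zariski_closed id (Z g)" using Z(1)[of g] by (auto simp: irreducible_closed_def)
    ultimately obtain n f where f: "hform n f" "\<And>Q. Q \<in> Z g \<Longrightarrow> f (hcoords Q) = 0"
      "f (hcoords P) \<noteq> 0"
      using zariski_closed_point_in by blast
    then have "f x = 0" using x(2)[of n f] by (auto simp: vanishing_ideal_def)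
    then show False using at_P[OF f(1)] f(3) by simp
  qed
  then have "P \<in> V" using Z(1)[of g] by auto
  moreover have "f (hcoords P) = 0" if "(a, f) \<in> set gs" for a f
    using at_P x(3)[OF that] gs[OF that] by blast
  ultimately show ?thesis using that by blast
qed

section \<open>Addition laws on the antidiagonal\<close>

lemma ideal_evalp_zero:
  fixes h :: "'a::comm_ring_1 \<Rightarrow> 'b::comm_ring_1"
  assumes h: "ring_morphism h"
  shows "ideal {q :: ('v, 'a) mpol. evalp h q x = 0} mpol_ring"
proof -
  interpret R: ring "mpol_ring :: ('v, 'a) mpol ring" by (rule ring_from_type_algebra)
  have carrier: "a \<in> carrier (mpol_ring :: ('v, 'a) mpol ring)"
    and add: "a \<oplus>\<^bsub>mpol_ring\<^esub> b = a + b" and zero: "\<zero>\<^bsub>mpol_ring\<^esub> = (0 :: ('v, 'a) mpol)"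
    and mult: "a \<otimes>\<^bsub>mpol_ring\<^esub> b = a * b" for a b :: "('v, 'a) mpol"
    by (auto simp: ring_of_type_algebra_def)
  have minus: "\<ominus>\<^bsub>mpol_ring\<^esub> a = - a" for a :: "('v, 'a) mpol"
    using R.minus_equality[of "- a" a] by (simp add: carrier add zero)
  show ?thesis
  proof (rule idealI[OF R.ring_axioms])
    show "subgroup {q :: ('v, 'a) mpol. evalp h q x = 0} (add_monoid mpol_ring)"
    proof (rule group.subgroupI[OF R.a_group])
      show "{q :: ('v, 'a) mpol. evalp h q x = 0} \<noteq> {}" using evalp_zero[OF h] by blast
      show "inv\<^bsub>add_monoid mpol_ring\<^esub> a \<in> {q :: ('v, 'a) mpol. evalp h q x = 0}"
        if "a \<in> {q. evalp h q x = 0}" for a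
        using that by (simp only: minus[unfolded a_inv_def] mem_Collect_eq evalp_uminus[OF h]) simp
    qed (auto simp: carrier add evalp_add[OF h])
  qed (auto simp: mult evalp_mult[OF h])
qed

lemma evalp_genideal_zero:
  fixes h :: "'a::comm_ring_1 \<Rightarrow> 'b::comm_ring_1" and T :: "('v, 'a) mpol set"
  assumes "ring_morphism h" "\<And>q. q \<in> T \<Longrightarrow> evalp h q x = 0" "p \<in> Idl\<^bsub>mpol_ring\<^esub> T"
  shows "evalp h p x = 0"
proof -
  interpret R: ring "mpol_ring :: ('v, 'a) mpol ring" by (rule ring_from_type_algebra)
  show ?thesis
    using R.genideal_minimal[OF ideal_evalp_zero[OF assms(1), of x], of T] assms(2,3) by auto
qed

lemma evalp_hom_ideal:
  assumes "ring_morphism h" "P \<in> V" "p \<in> hom_ideal h V"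
  shows "evalp h p (hcoords P) = 0"
  using assms(2) by (intro evalp_genideal_zero[OF assms(1) _ assms(3)[unfolded hom_ideal_def]]) auto

lemma evalp_product_ideal:
  assumes "z \<in> V \<times> V" "p \<in> product_ideal V"
  shows "evalp to_ac p (hcoords2 z) = 0"
proof (rule evalp_genideal_zero[OF ring_morphism_to_ac _ assms(2)[unfolded product_ideal_def]])
  fix q assume "q \<in> rename_vars Inl ` hom_ideal to_ac V \<union> rename_vars Inr ` hom_ideal to_ac V"
  then show "evalp to_ac q (hcoords2 z) = 0"
    using assms(1) evalp_hom_ideal[OF ring_morphism_to_ac]
    by (auto simp: evalp_rename_vars[OF ring_morphism_to_ac] comp_def)
qed

text \<open>Two representatives differ by an element of the product ideal, which vanishes on
  \<open>V \<times> V\<close>; so \<open>the_elem\<close> is applied to a singleton.\<close>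

lemma coset_value_eq:
  assumes "c \<in> carrier (bicoord_ring V)" "q \<in> c" "z \<in> V \<times> V"
  shows "coset_value z c = evalp to_ac q (hcoords2 z)"
proof -
  obtain a where c: "c = (\<lambda>p. p + a) ` product_ideal V"
    using assms(1) by (auto simp: FactRing_def A_RCOSETS_def' a_r_coset_def' ring_of_type_algebra_def)
  have "evalp to_ac p (hcoords2 z) = evalp to_ac a (hcoords2 z)" if "p \<in> c" for p
    using that evalp_product_ideal[OF assms(3)]
    by (auto simp: c evalp_add[OF ring_morphism_to_ac])
  then have "(\<lambda>q. evalp to_ac q (hcoords2 z)) ` c = {evalp to_ac q (hcoords2 z)}"
    using assms(2) by force
  then show ?thesis by (simp add: coset_value_def)
qed

section \<open>The inverse map in linear forms\<close>

lemma k_open_basic: "is_form n F \<Longrightarrow> k_open {Q. evalp to_ac F (hcoords Q) \<noteq> 0}"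
  unfolding zariski_closed_def by (intro exI[of _ "{F}"]) auto

lemma k_open_contains_basic:
  assumes "k_open W" "P \<in> W"
  obtains n F where "is_form n F" "evalp to_ac F (hcoords P) \<noteq> 0"
    "\<And>Q. evalp to_ac F (hcoords Q) \<noteq> 0 \<Longrightarrow> Q \<in> W"
proof -
  obtain T where T: "\<forall>F\<in>T. \<exists>n. is_form n F" "- W = {P. \<forall>F\<in>T. evalp to_ac F (hcoords P) = 0}"
    using assms(1) by (auto simp: zariski_closed_def)
  then obtain F n where "F \<in> T" "is_form n F" "evalp to_ac F (hcoords P) \<noteq> 0"
    using assms(2) by blast
  then show ?thesis using that[of n F] T(2) by blast
qed

lemma chart_O1: "chart O1 i = {P. hcoords P i \<noteq> 0}"
  and trans_O1: "trans O1 i j P = hcoords P j / hcoords P i"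
  by (auto simp: O1_def)

text \<open>
  The isomorphism of \<open>[-1]\<^sup>* \<O>(1)\<close> with \<open>\<O>(1)\<close> maps the sections \<open>X\<^sub>t \<circ> [-1]\<close> to global sections of
  \<open>\<O>(1)\<close>, which are linear forms by projective normality.
\<close>

lemma ex_linear_inverse:
  fixes A :: "('i::finite, 'k::field alg_closure) proj_space monoid"
  assumes "abelian_variety A" "symmetric_embedding A" "projectively_normal (carrier A)"
  obtains L :: "'i \<Rightarrow> ('i, 'k) mpol" where "\<And>t. is_form 1 (L t)"
    "\<And>P. P \<in> carrier A \<Longrightarrow> has_hcoords (inv\<^bsub>A\<^esub> P) (\<lambda>t. evalp to_ac (L t) (hcoords P))"
proof -
  let ?V = "carrier A"
  define y where "y = (\<lambda>P. hcoords (inv\<^bsub>A\<^esub> P))"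
  have morph: "k_morphism ?V (\<lambda>P. inv\<^bsub>A\<^esub> P)"
    using assms(1) by (auto simp: abelian_variety_def)
  let ?M = "lb_pullback (\<lambda>P. inv\<^bsub>A\<^esub> P) O1 :: ('i, ('i, 'k alg_closure) proj_space, 'k alg_closure) line_bundle"
  let ?O1 = "O1 :: ('i, ('i, 'k alg_closure) proj_space, 'k alg_closure) line_bundle"
  have charts: "chart ?M j = {P. y P j \<noteq> 0}" "trans ?M j l P = y P l / y P j" for j l P
    by (auto simp: lb_pullback_def chart_O1 trans_O1 y_def)
  obtain h where h: "\<And>j a. regular_on (?V \<inter> chart ?M j \<inter> chart ?O1 a) (h j a)"
    "\<And>j a P. P \<in> ?V \<inter> chart ?M j \<inter> chart ?O1 a \<Longrightarrow> h j a P \<noteq> 0"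
    "\<And>j l a b P. P \<in> ?V \<inter> chart ?M j \<inter> chart ?M l \<inter> chart ?O1 a \<inter> chart ?O1 b \<Longrightarrow>
        h j a P * trans ?M j l P = trans ?O1 a b P * h l b P"
    using assms(2) unfolding symmetric_embedding_def lb_iso_def by blast
  have h_reg: "regular_on (?V \<inter> {P. y P j \<noteq> 0} \<inter> {P. hcoords P a \<noteq> 0}) (h j a)" for j a
    using h(1) unfolding charts chart_O1 .
  have h_nz: "h j a P \<noteq> 0" if "P \<in> ?V" "y P j \<noteq> 0" "hcoords P a \<noteq> 0" for j a P
    using h(2)[of P j a] that by (simp add: charts chart_O1)
  have h_trans: "h j a P * (y P l / y P j) = hcoords P b / hcoords P a * h l b P"
    if "P \<in> ?V" "y P j \<noteq> 0" "y P l \<noteq> 0" "hcoords P a \<noteq> 0" "hcoords P b \<noteq> 0" for j l a b P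
    using h(3)[of P j l a b] that by (simp add: charts chart_O1 trans_O1)
  \<comment> \<open>The case \<open>a = b\<close> of the cocycle condition.\<close>
  have h_change: "h j a P / y P j = h l a P / y P l"
    if "P \<in> ?V" "y P j \<noteq> 0" "y P l \<noteq> 0" "hcoords P a \<noteq> 0" for j l a P
    using h_trans[of P j l a a] that by (simp add: field_simps)
  define J where "J = (\<lambda>P. SOME j. y P j \<noteq> 0)"
  have J: "y P (J P) \<noteq> 0" for P
  proof -
    have "\<exists>j. y P j \<noteq> 0" unfolding y_def using hcoords_nonzero by (metis ext)
    then show ?thesis unfolding J_def by (rule someI_ex)
  qed
  \<comment> \<open>In the chart \<open>a\<close> this is the image of the section
    \<open>X\<^sub>t \<circ> [-1]\<close>, computed in the trivialisation \<open>J P\<close>. By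
    \<open>h_change\<close> any other \<open>j\<close> with \<open>y P j \<noteq> 0\<close> gives
    the same value.\<close>
  define s where "s = (\<lambda>t a P. h (J P) a P * (y P t / y P (J P)))"
  have s_eq: "s t a P = h j a P * (y P t / y P j)"
    if "P \<in> ?V" "y P j \<noteq> 0" "hcoords P a \<noteq> 0" for t a P j
    unfolding s_def times_divide_eq_right using h_change[OF that(1,2) J that(3)]
    by (metis times_divide_eq_left)
  have reg: "regular_on (?V \<inter> {P. hcoords P a \<noteq> 0}) (s t a)" for t a
    unfolding regular_on_def
  proof
    fix P assume P: "P \<in> ?V \<inter> {P. hcoords P a \<noteq> 0}"
    \<comment> \<open>The index \<open>J Q\<close> varies with \<open>Q\<close>, but near
      \<open>P\<close> the fixed index \<open>j\<close> can be used instead, by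
      \<open>s_eq\<close>.\<close>
    define j where "j = J P"
    obtain W0 n0 F where W0: "k_open W0" "P \<in> W0" "\<And>i. is_form n0 (F i)"
      and F: "\<And>Q. Q \<in> ?V \<inter> W0 \<Longrightarrow> has_hcoords (inv\<^bsub>A\<^esub> Q) (\<lambda>i. evalp to_ac (F i) (hcoords Q))"
      using morph P unfolding k_morphism_def by blast
    have "P \<in> ?V \<inter> {P. y P j \<noteq> 0} \<inter> {P. hcoords P a \<noteq> 0}" using P J by (auto simp: j_def)
    with h_reg[of j a] obtain W1 n1 f g where
      W1: "k_open W1" "P \<in> W1" "is_form n1 f" "is_form n1 g" and
      fg: "\<forall>Q\<in>?V \<inter> {P. y P j \<noteq> 0} \<inter> {P. hcoords P a \<noteq> 0} \<inter> W1.
          evalp to_ac g (hcoords Q) \<noteq> 0 \<and>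
          h j a Q = evalp to_ac f (hcoords Q) / evalp to_ac g (hcoords Q)"
      unfolding regular_on_def by blast
    obtain m0 e0 where e0: "is_form m0 e0" "evalp to_ac e0 (hcoords P) \<noteq> 0"
      "\<And>Q. evalp to_ac e0 (hcoords Q) \<noteq> 0 \<Longrightarrow> Q \<in> W0"
      using k_open_contains_basic[OF W0(1,2)] by blast
    obtain m1 e1 where e1: "is_form m1 e1" "evalp to_ac e1 (hcoords P) \<noteq> 0"
      "\<And>Q. evalp to_ac e1 (hcoords Q) \<noteq> 0 \<Longrightarrow> Q \<in> W1"
      using k_open_contains_basic[OF W1(1,2)] by blast
    note evm = evalp_mult[OF ring_morphism_to_ac]
    \<comment> \<open>Where \<open>E\<close> is nonzero, a point of the variety lies in
      \<open>W0\<close> and \<open>W1\<close> and its inverse has nonzero \<open>j\<close>-th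
      coordinate. There \<open>s t a\<close> is the product of the fractions for
      \<open>h j a\<close> and for \<open>y t / y j\<close>.\<close>
    define E where "E = e0 * (e1 * F j)"
    define W where "W = {Q. evalp to_ac E (hcoords Q) \<noteq> 0}"
    have inv_coords: "\<exists>c. c \<noteq> 0 \<and> (\<forall>i. evalp to_ac (F i) (hcoords Q) = c * y Q i)"
      if "Q \<in> ?V \<inter> W0" for Q
      using F[OF that] by (auto simp: has_hcoords_iff y_def fun_eq_iff)
    have "is_form (m0 + (m1 + n0)) E"
      unfolding E_def by (intro is_form_mult e0 e1 W0)
    then have "k_open W" unfolding W_def by (rule k_open_basic)
    moreover have "P \<in> W"
      using inv_coords[of P] P W0(2) e0(2) e1(2) J[of P] by (auto simp: W_def E_def evm j_def)
    moreover have "is_form (n1 + n0) (f * F t)" "is_form (n1 + n0) (g * F j)"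
      by (intro is_form_mult W0 W1)+
    moreover have "evalp to_ac (g * F j) (hcoords Q) \<noteq> 0 \<and>
        s t a Q = evalp to_ac (f * F t) (hcoords Q) / evalp to_ac (g * F j) (hcoords Q)"
      if Q: "Q \<in> ?V \<inter> {P. hcoords P a \<noteq> 0} \<inter> W" for Q
    proof -
      have nz: "evalp to_ac e0 (hcoords Q) \<noteq> 0" "evalp to_ac e1 (hcoords Q) \<noteq> 0"
        "evalp to_ac (F j) (hcoords Q) \<noteq> 0"
        using Q by (auto simp: W_def E_def evm)
      obtain c where c: "c \<noteq> 0" "\<And>i. evalp to_ac (F i) (hcoords Q) = c * y Q i"
        using inv_coords[of Q] Q e0(3)[OF nz(1)] by blast
      then have "y Q j \<noteq> 0" using nz(3) by auto
      then have "s t a Q = h j a Q * (y Q t / y Q j)" using s_eq Q by blast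
      moreover have "y Q t / y Q j = evalp to_ac (F t) (hcoords Q) / evalp to_ac (F j) (hcoords Q)"
        using c by simp
      ultimately show ?thesis
        using fg[rule_format, of Q] Q \<open>y Q j \<noteq> 0\<close> e1(3)[OF nz(2)] nz(3) by (simp add: evm)
    qed
    ultimately show "\<exists>W n F G. k_open W \<and> P \<in> W \<and> is_form n F \<and> is_form n G \<and>
        (\<forall>Q\<in>?V \<inter> {P. hcoords P a \<noteq> 0} \<inter> W. evalp to_ac G (hcoords Q) \<noteq> 0 \<and>
           s t a Q = evalp to_ac F (hcoords Q) / evalp to_ac G (hcoords Q))"
      by blast
  qed
  have "s t \<in> lb_sections ?V (lb_power O1 1)" for t
  proof -
    have "s t a P = (hcoords P b / hcoords P a) ^ 1 * s t b P"
      if "P \<in> ?V" "hcoords P a \<noteq> 0" "hcoords P b \<noteq> 0" for a b P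
      using h_trans[OF that(1) J J that(2,3)] J[of P] by (simp add: s_def)
    with reg[of _ t] show ?thesis
      unfolding lb_sections_def lb_power_def by (auto simp: chart_O1 trans_O1)
  qed
  then have "\<exists>F. is_form 1 F \<and> (\<forall>i. \<forall>P\<in>?V \<inter> chart O1 i.
      s t i P = evalp to_ac F (hcoords P) / hcoords P i ^ 1)" for t
    using assms(3) unfolding projectively_normal_def by blast
  then have "\<forall>t. \<exists>F. is_form 1 F \<and> (\<forall>i. \<forall>P\<in>?V \<inter> chart O1 i.
      s t i P = evalp to_ac F (hcoords P) / hcoords P i ^ 1)" by blast
  from choice[OF this] obtain L :: "'i \<Rightarrow> ('i, 'k) mpol" where L: "\<And>t. is_form 1 (L t)"
    "\<And>t i P. P \<in> ?V \<Longrightarrow> hcoords P i \<noteq> 0 \<Longrightarrow> s t i P = evalp to_ac (L t) (hcoords P) / hcoords P i"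
    by (auto simp: chart_O1)
  have "has_hcoords (inv\<^bsub>A\<^esub> P) (\<lambda>t. evalp to_ac (L t) (hcoords P))" if P: "P \<in> ?V" for P
  proof -
    obtain a where a: "hcoords P a \<noteq> 0" using hcoords_nonzero by (metis ext)
    \<comment> \<open>The factor common to all \<open>t\<close>; it is nonzero because
      \<open>h\<close> takes unit values.\<close>
    define c where "c = h (J P) a P * hcoords P a / y P (J P)"
    have "evalp to_ac (L t) (hcoords P) = c * hcoords (inv\<^bsub>A\<^esub> P) t" for t
      using L(2)[OF P a, of t] a by (simp add: s_def c_def y_def field_simps)
    moreover have "c \<noteq> 0" using h_nz[OF P J a] a J[of P] by (simp add: c_def)
    ultimately show ?thesis unfolding has_hcoords_iff by auto
  qed
  then show ?thesis using that L(1) by blast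
qed

text \<open>
  A law of bidegree \<open>(0, 0)\<close> would make the group law constant on a nonempty open set, whose
  horizontal slices then consist of one point; but a point is not dense in \<open>A\<close>.
\<close>

lemma addition_law_bidegree_pos:
  fixes A :: "('i::finite, 'k::field alg_closure) proj_space monoid"
  assumes A: "abelian_variety A" and "krull_dim (carrier A) = enat g" "g > 0"
    and law: "addition_law A m n p"
  shows "m + n > 0"
proof (rule ccontr)
  assume "\<not> m + n > 0"
  then have mn: "m = 0" "n = 0" by auto
  let ?V = "carrier A"
  interpret group A using A by (simp add: abelian_variety_def)
  have irr: "irreducible_closed ?V"
    using A by (simp add: abelian_variety_def projective_variety_def)
  have const: "coset_value z (p i) = coset_value w (p i)" if "z \<in> ?V \<times> ?V" "w \<in> ?V \<times> ?V" for z w i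
  proof -
    obtain q where q: "p i \<in> carrier (bicoord_ring ?V)" "q \<in> p i" "is_biform 0 0 q"
      using law by (auto simp: addition_law_def bihomogeneous_def mn)
    have "hform 0 (evalp to_ac q)" using hform_evalp[OF is_biform_imp_is_form[OF q(3)]] by simp
    then show ?thesis
      unfolding coset_value_eq[OF q(1,2) that(1)] coset_value_eq[OF q(1,2) that(2)]
      by (rule hform_0_const)
  qed
  obtain U z where U: "law_defined_on A p U" "z \<in> U" using law by (auto simp: addition_law_def)
  obtain P0 Q0 where z: "z = (P0, Q0)" by force
  obtain W where W: "k_open2 W" "U = (?V \<times> ?V) \<inter> W"
    using U by (auto simp: law_defined_on_def open_in_square_def)
  obtain T where T: "\<forall>F\<in>T. \<exists>m n. is_biform m n F"
    "- W = {z. \<forall>F\<in>T. evalp to_ac F (hcoords2 z) = 0}"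
    using W(1) by (auto simp: zariski_closed2_def)
  have "z \<in> W" using U(2) W(2) by auto
  then have "\<exists>F\<in>T. evalp to_ac F (hcoords2 z) \<noteq> 0" using T(2) by blast
  then obtain F d e where F: "F \<in> T" "is_biform d e F" "evalp to_ac F (hcoords2 z) \<noteq> 0"
    using T(1) by blast
  \<comment> \<open>The slice of \<open>F\<close> with second argument \<open>Q0\<close>: where
    \<open>f\<close> is nonzero at a point \<open>P\<close> of \<open>A\<close>, the pair
    \<open>(P, Q0)\<close> lies in \<open>U\<close>.\<close>
  define f where "f = (\<lambda>x. evalp to_ac F (case_sum (\<lambda>i. x i) (\<lambda>i. hcoords Q0 i)))"
  have f: "hform (1 * d + 0 * e) f"
    unfolding f_def by (intro hform_evalp_substitute F hform_var hform_const)
  have prod: "has_hcoords (P \<otimes>\<^bsub>A\<^esub> Q) (\<lambda>i. coset_value (P, Q) (p i))" if "(P, Q) \<in> U" for P Q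
    using U(1) that by (auto simp: law_defined_on_def)
  have "?V \<subseteq> {P. f (hcoords P) = 0} \<union> {P0}"
  proof
    fix P assume P: "P \<in> ?V"
    show "P \<in> {P. f (hcoords P) = 0} \<union> {P0}"
    proof (cases "f (hcoords P) = 0")
      case False
      then have "(P, Q0) \<in> W" using T(2) F(1) by (force simp: f_def)
      then have PU: "(P, Q0) \<in> U" using P U(2) W(2) z by auto
      have "(P0, Q0) \<in> U" using U(2) z by simp
      moreover from this have "coset_value (P, Q0) (p i) = coset_value (P0, Q0) (p i)" for i
        using PU W(2) by (intro const) auto
      \<comment> \<open>The law has the same value at both pairs, so the products agree and
        \<open>Q0\<close> can be cancelled.\<close>
      ultimately have "P \<otimes>\<^bsub>A\<^esub> Q0 = P0 \<otimes>\<^bsub>A\<^esub> Q0"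
        using has_hcoords_unique[OF prod[OF PU]] prod[of P0 Q0] by simp
      then show ?thesis using P U(2) W(2) z r_cancel by auto
    qed auto
  qed
  moreover have "P0 \<in> ?V" "f (hcoords P0) \<noteq> 0" using U(2) W(2) z F(3) by (auto simp: f_def)
  ultimately have V: "?V \<subseteq> {P0}"
    using irr zariski_closed_hform[OF f] zariski_closed_point[of P0]
    unfolding irreducible_closed_def by blast
  \<comment> \<open>A strict chain of nonempty closed sets of positive length does not fit into a
    single point.\<close>
  obtain Z where Z: "\<And>i. i \<le> g \<Longrightarrow> irreducible_closed (Z i) \<and> Z i \<subseteq> ?V"
    "\<And>i. i < g \<Longrightarrow> Z i \<subset> Z (Suc i)"
    using krull_dim_eq_enat[OF assms(2,3)] by blast
  have "Z 0 \<noteq> {}" using Z(1)[of 0] by (auto simp: irreducible_closed_def)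
  moreover have "Z 0 \<subset> Z 1" "Z 1 \<subseteq> {P0}" using Z(1)[of 1] Z(2)[of 0] V assms(3) by auto
  ultimately show False by blast
qed

text \<open>Where \<open>p\<close> is defined at \<open>(P, inv P)\<close>, its value represents the
  neutral element, so the coordinate \<open>p i\<close> is nonzero for an index \<open>i\<close>
  that does not depend on \<open>P\<close>. Substituting the linear forms \<open>L\<close> for the
  second argument turns this coordinate into one form in \<open>P\<close>.\<close>

lemma ex_antidiagonal_form:
  fixes A :: "('i::finite, 'k::field alg_closure) proj_space monoid"
  assumes A: "abelian_variety A"
    and L: "\<And>t. is_form 1 (L t)"
      "\<And>P. P \<in> carrier A \<Longrightarrow> has_hcoords (inv\<^bsub>A\<^esub> P) (\<lambda>t. evalp to_ac (L t) (hcoords P))"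
    and law: "addition_law A m n p"
  shows "\<exists>G. hform (m + n) G \<and> (\<forall>P\<in>carrier A. \<forall>U. (P, inv\<^bsub>A\<^esub> P) \<in> U \<longrightarrow>
      law_defined_on A p U \<longrightarrow> G (hcoords P) \<noteq> 0)"
proof -
  interpret group A using A by (simp add: abelian_variety_def)
  obtain i where i: "hcoords \<one>\<^bsub>A\<^esub> i \<noteq> 0" using hcoords_nonzero by (metis ext)
  obtain q where q: "p i \<in> carrier (bicoord_ring (carrier A))" "q \<in> p i" "is_biform m n q"
    using law by (auto simp: addition_law_def bihomogeneous_def)
  define G where "G = (\<lambda>x. evalp to_ac q (case_sum (\<lambda>i. x i) (\<lambda>i. evalp to_ac (L i) x)))"
  have "hform (1 * m + 1 * n) G"
    unfolding G_def by (intro hform_evalp_substitute q hform_var hform_evalp L)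
  moreover have "G (hcoords P) \<noteq> 0"
    if P: "P \<in> carrier A" and U: "(P, inv\<^bsub>A\<^esub> P) \<in> U" "law_defined_on A p U" for P U
  proof -
    let ?y = "hcoords (inv\<^bsub>A\<^esub> P)"
    obtain c where c: "c \<noteq> 0" "(\<lambda>t. evalp to_ac (L t) (hcoords P)) = (\<lambda>t. c * ?y t)"
      using L(2)[OF P] by (auto simp: has_hcoords_iff)
    \<comment> \<open>\<open>L\<close> yields the coordinates of the inverse only up to a factor
      \<open>c\<close>. With the first argument frozen, homogeneity of degree \<open>n\<close> in
      the second turns it into the nonzero factor \<open>c ^ n\<close>.\<close>
    have "hform (0 * m + 1 * n) (\<lambda>x. evalp to_ac q (case_sum (\<lambda>i. hcoords P i) (\<lambda>i. x i)))"
      by (intro hform_evalp_substitute q hform_var hform_const)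
    from hform_homogeneous[OF this, of c ?y]
    have "G (hcoords P) = c ^ n * evalp to_ac q (hcoords2 (P, inv\<^bsub>A\<^esub> P))"
      unfolding G_def c(2) by simp
    moreover have "has_hcoords (P \<otimes>\<^bsub>A\<^esub> inv\<^bsub>A\<^esub> P) (\<lambda>i. coset_value (P, inv\<^bsub>A\<^esub> P) (p i))"
      using U by (auto simp: law_defined_on_def)
    then have "has_hcoords \<one>\<^bsub>A\<^esub> (\<lambda>i. coset_value (P, inv\<^bsub>A\<^esub> P) (p i))" using P by simp
    then have "coset_value (P, inv\<^bsub>A\<^esub> P) (p i) \<noteq> 0"
      using i by (auto simp: has_hcoords_iff dest: fun_cong[of _ _ i])
    then have "evalp to_ac q (hcoords2 (P, inv\<^bsub>A\<^esub> P)) \<noteq> 0"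
      using coset_value_eq[OF q(1,2), of "(P, inv\<^bsub>A\<^esub> P)"] P by simp
    ultimately show ?thesis using c(1) by simp
  qed
  ultimately show ?thesis by (intro exI[of _ G]) auto
qed

theorem theorem1:
  fixes A :: "('i::finite, 'k::field alg_closure) proj_space monoid"
    and g :: nat
    and S :: "('i \<Rightarrow> ('i + 'i, 'k) mpol set) set"
  assumes "abelian_variety A"
    and "krull_dim (carrier A) = enat g"
    and "symmetric_embedding A"
    and "projectively_normal (carrier A)"
    and "complete_addition_laws A S"
  shows "infinite S \<or> g + 1 \<le> card S"
proof (rule ccontr)
  assume "\<not> (infinite S \<or> g + 1 \<le> card S)"
  then have S: "finite S" "card S \<le> g" by auto
  interpret group A using assms(1) by (simp add: abelian_variety_def)
  have laws: "\<exists>m n. addition_law A m n p" if "p \<in> S" for p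
    using assms(5) that by (auto simp: complete_addition_laws_def)
  have complete: "\<exists>p\<in>S. \<exists>U. (P, inv\<^bsub>A\<^esub> P) \<in> U \<and> law_defined_on A p U" if "P \<in> carrier A" for P
    using assms(5) that by (auto simp: complete_addition_laws_def)
  \<comment> \<open>Some law is defined at the pair of the neutral element with its inverse. This
    settles dimension 0, and afterwards \<open>g > 0\<close> gives the forms positive
    degree.\<close>
  have "S \<noteq> {}" using complete[OF one_closed] by auto
  then have "g > 0" using S by (metis card_gt_0_iff less_le_trans)
  obtain L :: "'i \<Rightarrow> ('i, 'k) mpol" where L: "\<And>t. is_form 1 (L t)"
    "\<And>P. P \<in> carrier A \<Longrightarrow> has_hcoords (inv\<^bsub>A\<^esub> P) (\<lambda>t. evalp to_ac (L t) (hcoords P))"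
    using ex_linear_inverse[OF assms(1,3,4)] by blast
  have "\<forall>p\<in>S. \<exists>aG. hform (fst aG) (snd aG) \<and> fst aG > 0 \<and>
      (\<forall>P\<in>carrier A. \<forall>U. (P, inv\<^bsub>A\<^esub> P) \<in> U \<longrightarrow> law_defined_on A p U \<longrightarrow> snd aG (hcoords P) \<noteq> 0)"
  proof
    fix p assume "p \<in> S"
    then obtain m n where p: "addition_law A m n p" using laws by blast
    from ex_antidiagonal_form[OF assms(1) L p] obtain G where
      "hform (m + n) G" "\<forall>P\<in>carrier A. \<forall>U. (P, inv\<^bsub>A\<^esub> P) \<in> U \<longrightarrow>
        law_defined_on A p U \<longrightarrow> G (hcoords P) \<noteq> 0" by blast
    with addition_law_bidegree_pos[OF assms(1,2) \<open>g > 0\<close> p]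
    show "\<exists>aG. hform (fst aG) (snd aG) \<and> fst aG > 0 \<and>
        (\<forall>P\<in>carrier A. \<forall>U. (P, inv\<^bsub>A\<^esub> P) \<in> U \<longrightarrow> law_defined_on A p U \<longrightarrow> snd aG (hcoords P) \<noteq> 0)"
      by (intro exI[of _ "(m + n, G)"]) auto
  qed
  from bchoice[OF this] obtain G where G:
    "\<And>p. p \<in> S \<Longrightarrow> hform (fst (G p)) (snd (G p)) \<and> fst (G p) > 0"
    "\<And>p P U. p \<in> S \<Longrightarrow> P \<in> carrier A \<Longrightarrow> (P, inv\<^bsub>A\<^esub> P) \<in> U \<Longrightarrow> law_defined_on A p U \<Longrightarrow>
      snd (G p) (hcoords P) \<noteq> 0" by blast
  obtain ps where ps: "set ps = S" "length ps = card S"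
    using S(1) by (metis finite_distinct_list distinct_card)
  have "irreducible_closed (carrier A)"
    using assms(1) by (simp add: abelian_variety_def projective_variety_def)
  moreover have "hform a f \<and> a > 0" if "(a, f) \<in> set (map G ps)" for a f
    using that G(1) ps(1) by (metis (mono_tags, lifting) fst_conv image_iff list.set_map snd_conv)
  moreover have "length (map G ps) \<le> g" using ps S by simp
  ultimately obtain P where P: "P \<in> carrier A"
    "\<And>a f. (a, f) \<in> set (map G ps) \<Longrightarrow> f (hcoords P) = 0"
    using ex_common_zero_on_variety[OF _ assms(2) \<open>g > 0\<close>] by blast
  \<comment> \<open>At the common zero \<open>P\<close> some law is defined at
    \<open>(P, inv P)\<close>, yet its form vanishes at \<open>P\<close>.\<close>
  obtain p U where p: "p \<in> S" "(P, inv\<^bsub>A\<^esub> P) \<in> U" "law_defined_on A p U"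
    using complete[OF P(1)] by blast
  have "(fst (G p), snd (G p)) \<in> set (map G ps)" using p(1) ps(1) by auto
  then show False using P(2) G(2)[OF p(1) P(1) p(2,3)] by blast
qed

end
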